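(* A $2n$-dimensional almost Abelian Lie algebra $\mathbb R^{2n-1}\rtimes_f\mathbb R$ admits an SKT structure if and only if (i) either $f$ is diagonalizable over the complex numbers and there is one real eigenvalue $a\in\mathbb R$ such that the other complex eigenvalues (counted with multiplicity) come in $n-1$ pairs $(z_i,\overline z_i)$ with $\operatorname{Re}(z_i)\in\{0,-\tfrac a2\}$, $i=1,\dots,n-1$, (ii) or the complex Jordan normal form of $f$ has one Jordan block of size $2$ with eigenvalue $0$ and all other Jordan blocks are of size $1$ with eigenvalues $ib_1,-ib_1,\dots,ib_{n-2},-ib_{n-2},0$ for certain real numbers $b_1,\dots,b_{n-2}\in\mathbb R$.
   Context: For $f\in\operatorname{End}(\mathbb R^{2n-1})$, $\mathbb R^{2n-1}\rtimes_f\mathbb R$ is the Lie algebra $\mathbb R^{2n-1}\oplus\mathbb R e$ in which $\mathbb R^{2n-1}$ is an Abelian ideal and $[e,v]=f(v)$ for $v\in\mathbb R^{2n-1}$. An SKT structure on a real Lie algebra $\mathfrak g$ is a pair $(g,J)$ of an inner product $g$ and an endomorphism $J$ with $J^2=-\mathrm{id}$, $g(J\cdot,J\cdot)=g$, such that $J$ is integrable ($[JX,JY]-J[JX,Y]-J[X,JY]-[X,Y]=0$ for all $X,Y$) and $d(J^*d\sigma)=0$ for $\sigma=g(J\cdot,\cdot)$, where $d$ is the Chevalley–Eilenberg differential and $(J^*\beta)(X_1,\dots,X_k)=\beta(JX_1,\dots,JX_k)$. *)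

theory Defs
  imports "HOL-Analysis.Analysis" "Jordan_Normal_Form.Jordan_Normal_Form"
begin

text \<open>A Lie algebra is a real vector space, given by its type, with a bracket \<open>br\<close>.\<close>

definition lie_bracket :: "('a::real_vector \<Rightarrow> 'a \<Rightarrow> 'a) \<Rightarrow> bool" where
  "lie_bracket br \<longleftrightarrow>
     bilinear br \<and>
     (\<forall>X. br X X = 0) \<and>
     (\<forall>X Y Z. br X (br Y Z) + br Y (br Z X) + br Z (br X Y) = 0)"

definition inner_product :: "('a::real_vector \<Rightarrow> 'a \<Rightarrow> real) \<Rightarrow> bool" where
  "inner_product g \<longleftrightarrow>
     bilinear g \<and> (\<forall>X Y. g X Y = g Y X) \<and> (\<forall>X. X \<noteq> 0 \<longrightarrow> g X X > 0)"

text \<open>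
  A \<open>k\<close>-form is represented by a function on lists of vectors, of which only the values on lists
  of length \<open>k\<close> are relevant.  The Chevalley--Eilenberg differential is
  \<open>(d \<beta>)(X\<^sub>0, \<dots>, X\<^sub>k) = \<Sum>\<^sub>i\<^sub><\<^sub>j (-1)\<^sup>i\<^sup>+\<^sup>j \<beta>([X\<^sub>i, X\<^sub>j], X\<^sub>0, \<dots>, X\<^sub>k)\<close>, where \<open>X\<^sub>i\<close> and \<open>X\<^sub>j\<close> are omitted
  from the trailing arguments.
\<close>

definition ce_diff :: "('a \<Rightarrow> 'a \<Rightarrow> 'a) \<Rightarrow> ('a list \<Rightarrow> real) \<Rightarrow> 'a list \<Rightarrow> real" where
  "ce_diff br \<beta> Xs =
     (\<Sum>j<length Xs. \<Sum>i<j.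
        (-1) ^ (i + j) * \<beta> (br (Xs ! i) (Xs ! j) # nths Xs (- {i, j})))"

definition form_pullback :: "('a \<Rightarrow> 'a) \<Rightarrow> ('a list \<Rightarrow> real) \<Rightarrow> 'a list \<Rightarrow> real" where
  "form_pullback J \<beta> Xs = \<beta> (map J Xs)"

definition fundamental_form :: "('a \<Rightarrow> 'a \<Rightarrow> real) \<Rightarrow> ('a \<Rightarrow> 'a) \<Rightarrow> 'a list \<Rightarrow> real" where
  "fundamental_form g J Xs = g (J (Xs ! 0)) (Xs ! 1)"

definition skt_structure ::
    "('a::real_vector \<Rightarrow> 'a \<Rightarrow> 'a) \<Rightarrow> ('a \<Rightarrow> 'a \<Rightarrow> real) \<Rightarrow> ('a \<Rightarrow> 'a) \<Rightarrow> bool" where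
  "skt_structure br g J \<longleftrightarrow>
     inner_product g \<and>
     linear J \<and> (\<forall>X. J (J X) = - X) \<and>
     (\<forall>X Y. g (J X) (J Y) = g X Y) \<and>
     (\<forall>X Y. br (J X) (J Y) - J (br (J X) Y) - J (br X (J Y)) - br X Y = 0) \<and>
     (\<forall>Xs. length Xs = 4 \<longrightarrow>
        ce_diff br (form_pullback J (ce_diff br (fundamental_form g J))) Xs = 0)"

text \<open>
  The bracket of \<open>V \<rtimes>\<^sub>f \<real>\<close> on \<open>V \<times> \<real>\<close>, with \<open>e = (0, 1)\<close> and \<open>V\<close> embedded as \<open>V \<times> {0}\<close>.
\<close>

definition almost_abelian_bracket ::
    "('v::real_vector \<Rightarrow> 'v) \<Rightarrow> 'v \<times> real \<Rightarrow> 'v \<times> real \<Rightarrow> 'v \<times> real" where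
  "almost_abelian_bracket f X Y = (snd X *\<^sub>R f (fst Y) - snd Y *\<^sub>R f (fst X), 0)"

lemma almost_abelian_bracket_ideal:
  shows "almost_abelian_bracket f (u, 0) (v, 0) = 0"
    and "almost_abelian_bracket f (0, 1) (v, 0) = (f v, 0)"
    and "snd (almost_abelian_bracket f X Y) = 0"
  by (simp_all add: almost_abelian_bracket_def zero_prod_def)

lemma lie_bracket_almost_abelian:
  assumes "linear f"
  shows "lie_bracket (almost_abelian_bracket f)"
proof -
  interpret linear f by fact
  show ?thesis
    unfolding lie_bracket_def bilinear_def
    by (auto simp: almost_abelian_bracket_def zero_prod_def add diff scale algebra_simps
        intro!: linearI)
qed

text \<open>
  The matrix of \<open>f\<close> with complex entries, in the standard basis of \<open>\<real>\<^sup>m\<close> ordered by some fixed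
  enumeration of the index type.  The enumeration affects it only up to similarity.
\<close>

definition complex_matrix :: "(real ^ 'm \<Rightarrow> real ^ 'm) \<Rightarrow> complex mat" where
  "complex_matrix f =
     Matrix.mat CARD('m) CARD('m)
       (\<lambda>(i, j). complex_of_real
          (vec_nth (f (axis (from_nat_into UNIV j) 1)) (from_nat_into UNIV i)))"

definition diagonalizable_mat :: "'a::semiring_1 mat \<Rightarrow> bool" where
  "diagonalizable_mat A \<longleftrightarrow> (\<exists>D. diagonal_mat D \<and> similar_mat A D)"

end

theory Submission
  imports Defs
begin

text \<open>
  Let \<open>N\<close> be a \<open>g\<close>-normal of the Abelian ideal, \<open>E = J N\<close>, and let \<open>V\<close> be the orthogonal complement of
  \<open>N\<close> and \<open>E\<close>. Integrability says that \<open>f\<close> preserves \<open>V\<close> and commutes there with \<open>J\<close>, so that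
  \<open>f E = a E + v\<close> with \<open>v \<in> V\<close>, and \<open>d(J\<^sup>*d\<sigma>) = 0\<close> says that \<open>L(L + a) g = 0\<close> on \<open>V\<close>, where
  \<open>(L h)(X, Y) = h(f X, Y) + h(X, f Y)\<close>. Evaluating this on eigenvectors and on Jordan chains of length
  two shows that \<open>f\<close> is diagonalizable over \<open>\<complex>\<close> on \<open>(V, J)\<close>, with eigenvalues of real part \<open>0\<close> or
  \<open>-a/2\<close>. The vector \<open>v\<close> can then be removed, unless \<open>a = 0\<close> and \<open>v\<close> has a component in the kernel
  of \<open>f\<close> on \<open>V\<close>, which produces the Jordan block of size two. Conversely, coordinates
  \<open>\<real> \<times> \<complex>\<^sup>k\<close> in which \<open>f\<close> has this form carry the obvious Hermitian structure. Such coordinates are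
  read off from a complex basis of (generalized) eigenfunctionals of \<open>f\<close> after making the basis stable
  under conjugation.
\<close>

section \<open>Hermitian structures in adapted coordinates\<close>

lemma ce_diff_3:
  "ce_diff br \<beta> [X, Y, Z] = - \<beta> [br X Y, Z] + \<beta> [br X Z, Y] - \<beta> [br Y Z, X]"
  by (simp add: ce_diff_def eval_nat_numeral lessThan_Suc nths_Cons)

lemma ce_diff_4:
  "ce_diff br \<beta> [X, Y, Z, W] =
     - \<beta> [br X Y, Z, W] + \<beta> [br X Z, Y, W] - \<beta> [br X W, Y, Z]
     - \<beta> [br Y Z, X, W] + \<beta> [br Y W, X, Z] - \<beta> [br Z W, X, Y]"
  by (simp add: ce_diff_def eval_nat_numeral lessThan_Suc nths_Cons)

lemma skt_structure_iff:
  "skt_structure br g J \<longleftrightarrow>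
     inner_product g \<and> linear J \<and> (\<forall>X. J (J X) = - X) \<and> (\<forall>X Y. g (J X) (J Y) = g X Y) \<and>
     (\<forall>X Y. br (J X) (J Y) - J (br (J X) Y) - J (br X (J Y)) - br X Y = 0) \<and>
     (\<forall>X Y Z W. ce_diff br (form_pullback J (ce_diff br (fundamental_form g J))) [X, Y, Z, W] = 0)"
proof -
  have "(\<forall>Xs. length Xs = 4 \<longrightarrow> P Xs) \<longleftrightarrow> (\<forall>X Y Z W. P [X, Y, Z, W])"
    for P :: "'a list \<Rightarrow> bool"
    by (auto simp: eval_nat_numeral length_Suc_conv)
  then show ?thesis
    unfolding skt_structure_def by presburger
qed

lemma bij_betw_enumeration:
  "bij_betw (from_nat_into (UNIV :: 'm::finite set)) {..<CARD('m)} UNIV"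
  using bij_betw_from_nat_into_finite[of "UNIV :: 'm set"] by simp

text \<open>An injective endomorphism of \<open>real ^ 'm\<close> is surjective; the functionals are
  assembled into one by reindexing them along the enumeration of \<open>'m\<close>.\<close>

lemma functionals_surj:
  fixes L :: "nat \<Rightarrow> real ^ 'm \<Rightarrow> real"
  assumes lin: "\<And>i. i < CARD('m) \<Longrightarrow> linear (L i)"
    and ker: "\<And>v. (\<And>i. i < CARD('m) \<Longrightarrow> L i v = 0) \<Longrightarrow> v = 0"
  shows "\<exists>v. \<forall>i<CARD('m). L i v = y i"
proof -
  let ?e = "from_nat_into (UNIV :: 'm set)"
  define idx where "idx = the_inv_into {..<CARD('m)} ?e"
  have bij: "bij_betw ?e {..<CARD('m)} UNIV"
    by (rule bij_betw_enumeration)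
  have idx: "idx j < CARD('m)" "?e (idx j) = j" for j
    using bij the_inv_into_into[of ?e "{..<CARD('m)}" j "{..<CARD('m)}"]
    unfolding idx_def by (auto simp: bij_betw_def f_the_inv_into_f)
  have idx': "idx (?e i) = i" if "i < CARD('m)" for i
    using bij that unfolding idx_def by (simp add: bij_betw_def the_inv_into_f_f)
  define \<Lambda> where "\<Lambda> v = (\<chi> j. L (idx j) v)" for v
  have lin\<Lambda>: "linear \<Lambda>"
    by (rule linearI) (auto simp: \<Lambda>_def Finite_Cartesian_Product.vec_eq_iff linear_add[OF lin[OF idx(1)]] linear_scale[OF lin[OF idx(1)]])
  moreover have "inj \<Lambda>"
  proof (subst linear_injective_0[OF lin\<Lambda>], intro allI impI)
    fix v assume "\<Lambda> v = 0"
    then have "L (idx j) v = 0" for j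
      by (simp add: \<Lambda>_def Finite_Cartesian_Product.vec_eq_iff)
    then show "v = 0"
      using ker idx' by metis
  qed
  ultimately have "surj \<Lambda>"
    by (rule linear_injective_imp_surjective) simp
  then obtain v where "\<Lambda> v = (\<chi> j. y (idx j))"
    by (metis surjD)
  then have "L (idx j) v = y (idx j)" for j
    by (simp add: \<Lambda>_def Finite_Cartesian_Product.vec_eq_iff)
  then show ?thesis
    using idx' by metis
qed

text \<open>
  The functionals \<open>c\<close> and \<open>\<zeta> 0, \<dots>, \<zeta> (k - 1)\<close> are coordinates identifying \<open>\<real>\<^sup>m\<close> with \<open>\<real> \<times> \<complex>\<^sup>k\<close>.
\<close>

locale normal_form =
  fixes f :: "real ^ 'm \<Rightarrow> real ^ 'm" and k :: nat and a :: real and z w :: "nat \<Rightarrow> complex"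
    and c :: "real ^ 'm \<Rightarrow> real" and \<zeta> :: "nat \<Rightarrow> real ^ 'm \<Rightarrow> complex"
  assumes lin_f: "linear f" and card: "CARD('m) = 2 * k + 1"
    and lin_c: "linear c" and lin_\<zeta>: "\<And>i. i < k \<Longrightarrow> linear (\<zeta> i)"
    and kernel: "\<And>v. c v = 0 \<Longrightarrow> (\<And>i. i < k \<Longrightarrow> \<zeta> i v = 0) \<Longrightarrow> v = 0"
    and c_f: "\<And>v. c (f v) = a * c v"
    and \<zeta>_f: "\<And>i v. i < k \<Longrightarrow> \<zeta> i (f v) = z i * \<zeta> i v + w i * of_real (c v)"
begin

lemma eqI: "c u = c v \<Longrightarrow> (\<And>i. i < k \<Longrightarrow> \<zeta> i u = \<zeta> i v) \<Longrightarrow> u = v"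
  using kernel[of "u - v"] by (simp add: linear_diff[OF lin_c] linear_diff[OF lin_\<zeta>])

text \<open>The real and imaginary parts of the \<open>\<zeta> i\<close>, followed by
  \<open>c\<close>, are \<open>2 * k + 1 = CARD('m)\<close> real functionals without a common zero,
  so \<open>functionals_surj\<close> applies.\<close>

lemma ex_coordinates: "\<exists>v. c v = d \<and> (\<forall>i<k. \<zeta> i v = \<xi> i)"
proof -
  define L where "L j = (if j < k then Re \<circ> \<zeta> j else if j < 2 * k then Im \<circ> \<zeta> (j - k) else c)" for j
  define y where "y j = (if j < k then Re (\<xi> j) else if j < 2 * k then Im (\<xi> (j - k)) else d)" for j
  have L: "(\<forall>j<2 * k + 1. P j) \<longleftrightarrow> (\<forall>i<k. P i \<and> P (k + i)) \<and> P (2 * k)" for P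
  proof safe
    fix j assume *: "\<forall>i<k. P i \<and> P (k + i)" "P (2 * k)" "j < 2 * k + 1"
    then consider "j < k" | "j = k + (j - k)" "j - k < k" | "j = 2 * k"
      by linarith
    then show "P j"
      by cases (use * in metis)+
  qed auto
  have lin_Re: "linear Re" and lin_Im: "linear Im"
    by (auto intro: linearI)
  have "linear (L j)" if "j < CARD('m)" for j
    using that unfolding L_def card
    by (auto intro!: linear_compose lin_Re lin_Im lin_\<zeta> lin_c)
  moreover have "v = 0" if "\<And>j. j < CARD('m) \<Longrightarrow> L j v = 0" for v
  proof -
    have "(\<forall>j<2 * k + 1. L j v = 0)"
      using that card by simp
    then show ?thesis
      unfolding L by (intro kernel) (auto simp: L_def complex_eq_iff)
  qed
  ultimately have "\<exists>v. \<forall>j<CARD('m). L j v = y j"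
    by (rule functionals_surj)
  then obtain v where "\<forall>j<2 * k + 1. L j v = y j"
    using card by auto
  then show ?thesis
    unfolding L by (intro exI[of _ v]) (auto simp: L_def y_def complex_eq_iff)
qed

text \<open>A quarter turn in the plane with coordinates \<open>c\<close> and \<open>snd\<close>,
  and multiplication by \<open>\<i>\<close> on each coordinate \<open>\<zeta> i\<close>. By
  \<open>eqI\<close> the choice is unique.\<close>

definition J where
  "J X = (SOME v. c v = snd X \<and> (\<forall>i<k. \<zeta> i v = \<i> * \<zeta> i (fst X)), - c (fst X))"

lemma J:
  "c (fst (J X)) = snd X" "snd (J X) = - c (fst X)"
  "i < k \<Longrightarrow> \<zeta> i (fst (J X)) = \<i> * \<zeta> i (fst X)"
  using someI_ex[OF ex_coordinates[of "snd X" "\<lambda>i. \<i> * \<zeta> i (fst X)"]]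
  unfolding J_def by auto

definition g where
  "g X Y = snd X * snd Y + c (fst X) * c (fst Y)
     + (\<Sum>i<k. Re (\<zeta> i (fst X) * cnj (\<zeta> i (fst Y))))"

lemma \<zeta>_scale: "i < k \<Longrightarrow> \<zeta> i (r *\<^sub>R v) = of_real r * \<zeta> i v"
  by (subst linear_scale[OF lin_\<zeta>]) (auto simp: scaleR_conv_of_real)

lemmas lin_simps = linear_add[OF lin_c] linear_scale[OF lin_c] linear_diff[OF lin_c] linear_neg[OF lin_c] linear_0[OF lin_c]
  linear_add[OF lin_\<zeta>] \<zeta>_scale linear_diff[OF lin_\<zeta>] linear_neg[OF lin_\<zeta>] linear_0[OF lin_\<zeta>]

lemma bracket_simps:
  "snd (almost_abelian_bracket f X Y) = 0"
  "fst (almost_abelian_bracket f X Y) = snd X *\<^sub>R f (fst Y) - snd Y *\<^sub>R f (fst X)"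
  by (simp_all add: almost_abelian_bracket_def)

lemma pair_eqI:
  "snd X = snd Y \<Longrightarrow> c (fst X) = c (fst Y) \<Longrightarrow> (\<And>i. i < k \<Longrightarrow> \<zeta> i (fst X) = \<zeta> i (fst Y)) \<Longrightarrow> X = Y"
  by (intro prod_eqI eqI)

lemma inner_product_g: "inner_product g"
  unfolding inner_product_def
proof (intro conjI allI impI)
  show "bilinear g"
    unfolding bilinear_def
    by (auto intro!: linearI simp: g_def lin_simps sum.distrib sum_distrib_left algebra_simps)
  show "g X Y = g Y X" for X Y
    by (simp add: g_def mult.commute)
  fix X :: "(real ^ 'm) \<times> real" assume "X \<noteq> 0"
  have eq: "g X X = (snd X)\<^sup>2 + (c (fst X))\<^sup>2 + (\<Sum>i<k. (cmod (\<zeta> i (fst X)))\<^sup>2)"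
    by (simp add: g_def power2_eq_square complex_mult_cnj cmod_power2 flip: power2_eq_square)
  have nn: "0 \<le> (\<Sum>i<k. (cmod (\<zeta> i (fst X)))\<^sup>2)"
    by (intro sum_nonneg) simp
  show "0 < g X X"
  proof (rule ccontr)
    assume "\<not> 0 < g X X"
    then have "(snd X)\<^sup>2 = 0" "(c (fst X))\<^sup>2 = 0" "(\<Sum>i<k. (cmod (\<zeta> i (fst X)))\<^sup>2) = 0"
      using nn eq zero_le_power2[of "snd X"] zero_le_power2[of "c (fst X)"] by linarith+
    then have "X = 0"
      by (intro pair_eqI) (auto simp: lin_simps sum_nonneg_eq_0_iff)
    then show False
      using \<open>X \<noteq> 0\<close> by simp
  qed
qed

lemma linear_J: "linear J"
  by (intro linearI pair_eqI) (auto simp: J lin_simps algebra_simps)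

lemma J_J: "J (J X) = - X"
  by (intro pair_eqI) (auto simp: J lin_simps)

lemma g_J: "g (J X) (J Y) = g X Y"
  by (simp add: g_def J)

text \<open>Compared coordinate by coordinate: on \<open>\<zeta> i\<close> the map \<open>f\<close>
  acts by a complex scalar, which commutes with \<open>\<i>\<close>, and the terms with
  \<open>w i\<close> cancel by antisymmetry in \<open>X\<close> and \<open>Y\<close>.\<close>

lemma integrable:
  "almost_abelian_bracket f (J X) (J Y) - J (almost_abelian_bracket f (J X) Y)
     - J (almost_abelian_bracket f X (J Y)) - almost_abelian_bracket f X Y = 0"
  by (intro pair_eqI)
     (auto simp: bracket_simps J lin_simps c_f \<zeta>_f algebra_simps)

text \<open>
  With \<open>t = snd\<close> and \<open>p = c \<circ> fst\<close>, the fundamental form satisfies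
  \<open>d\<sigma> = - t \<and> (S + p \<and> (K \<circ> J))\<close>; on \<open>ker t\<close> its pullback by \<open>J\<close> is therefore \<open>p \<and> S\<close>, and
  the derivation extending \<open>f\<close> scales \<open>p\<close> by \<open>a\<close> and \<open>S\<close>, modulo \<open>p\<close>, by \<open>-a\<close>.
\<close>

definition S where
  "S X Y = (\<Sum>i<k. 2 * Re (z i) * Re (\<i> * \<zeta> i (fst X) * cnj (\<zeta> i (fst Y))))"

definition K where
  "K X = (\<Sum>i<k. Re (w i * cnj (\<zeta> i (fst X))))"

abbreviation F where "F X \<equiv> (f (fst X), 0::real)"
abbreviation p where "p X \<equiv> c (fst X)"
abbreviation br where "br \<equiv> almost_abelian_bracket f"

lemma S_J: "S (J X) (J Y) = S X Y"
  by (simp add: S_def J algebra_simps)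

lemma S_flip: "S Y X = - S X Y"
  by (simp add: S_def sum_negf[symmetric] algebra_simps)

lemma S_br: "S (br X Y) Z = snd X * S (F Y) Z - snd Y * S (F X) Z"
  by (simp add: S_def bracket_simps lin_simps sum_distrib_left flip: sum_subtractf)
     (simp add: algebra_simps)

lemma K_minus: "K (- X) = - K X"
  by (simp add: K_def lin_simps flip: sum_negf)

lemma K_br: "K (br X Y) = snd X * K (F Y) - snd Y * K (F X)"
  by (simp add: K_def bracket_simps lin_simps sum_distrib_left flip: sum_subtractf)
     (simp add: algebra_simps)

lemma fundamental_form_eq:
  "fundamental_form g J [X, Y] = - p X * snd Y + snd X * p Y
     + (\<Sum>i<k. Re (\<i> * \<zeta> i (fst X) * cnj (\<zeta> i (fst Y))))"
  by (simp add: fundamental_form_def g_def J)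

lemma d_fundamental_form:
  "ce_diff br (fundamental_form g J) [X, Y, Z] =
     - (snd X * (S Y Z - p Y * K (J Z) + p Z * K (J Y))
      + snd Y * (S Z X - p Z * K (J X) + p X * K (J Z))
      + snd Z * (S X Y - p X * K (J Y) + p Y * K (J X)))"
  unfolding ce_diff_3 fundamental_form_eq S_def K_def
  by (simp add: bracket_simps lin_simps c_f \<zeta>_f J sum_distrib_left sum.distrib[symmetric] sum_subtractf[symmetric] sum_negf[symmetric])
     (simp add: algebra_simps sum.distrib sum_subtractf sum_distrib_left sum_negf)

text \<open>The trace left by the inhomogeneous terms \<open>w i * of_real (c v)\<close> when
  \<open>f\<close> is inserted into \<open>S\<close>; it occurs only next to a factor
  \<open>p\<close>.\<close>

definition \<psi> where
  "\<psi> X = (\<Sum>i<k. 2 * Re (z i) * Re (\<i> * w i * cnj (\<zeta> i (fst X))))"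

text \<open>Inserting \<open>f\<close> multiplies the summand at \<open>i\<close> by
  \<open>2 * Re (z i)\<close>. The summand already carries this factor, and the hypothesis turns its
  square into \<open>- a\<close> times itself.\<close>

lemma S_F:
  assumes "\<And>i. i < k \<Longrightarrow> Re (z i) \<in> {0, - a / 2}"
  shows "S (F X) Y + S X (F Y) = - a * S X Y + p X * \<psi> Y - p Y * \<psi> X"
proof -
  have *: "2 * Re (z i) * (2 * Re (z i)) = 2 * Re (z i) * (- a)" if "i < k" for i
    using assms[OF that] by auto
  have "2 * Re (z i) * Re (\<i> * \<zeta> i (f (fst X)) * cnj (\<zeta> i (fst Y)))
      + 2 * Re (z i) * Re (\<i> * \<zeta> i (fst X) * cnj (\<zeta> i (f (fst Y))))
     = - a * (2 * Re (z i) * Re (\<i> * \<zeta> i (fst X) * cnj (\<zeta> i (fst Y))))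
       + p X * (2 * Re (z i) * Re (\<i> * w i * cnj (\<zeta> i (fst Y))))
       - p Y * (2 * Re (z i) * Re (\<i> * w i * cnj (\<zeta> i (fst X))))" (is "?l = ?r") if "i < k" for i
  proof -
    have "?l = (2 * Re (z i) * (2 * Re (z i))) * Re (\<i> * \<zeta> i (fst X) * cnj (\<zeta> i (fst Y)))
       + p X * (2 * Re (z i) * Re (\<i> * w i * cnj (\<zeta> i (fst Y))))
       - p Y * (2 * Re (z i) * Re (\<i> * w i * cnj (\<zeta> i (fst X))))"
      using that by (simp add: \<zeta>_f algebra_simps)
    then show ?thesis
      unfolding *[OF that] by (simp only: mult.assoc mult.left_commute mult.commute)
  qed
  then show ?thesis
    unfolding S_def \<psi>_def by (simp add: sum_distrib_left flip: sum.distrib sum_subtractf)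
qed

text \<open>The pulled back 3-form is \<open>p \<and> (S + snd \<and> K)\<close>, and each bracket
  brings a factor \<open>snd\<close>. Hence the \<open>K\<close> part dies from
  \<open>snd \<and> snd = 0\<close>, the weights \<open>a\<close> of \<open>p\<close> and
  \<open>- a\<close> of \<open>S\<close> cancel, and \<open>\<psi>\<close> enters only through
  \<open>p \<and> p = 0\<close>.\<close>

lemma pluriclosed:
  assumes "\<And>i. i < k \<Longrightarrow> Re (z i) \<in> {0, - a / 2}"
  shows "ce_diff br (form_pullback J (ce_diff br (fundamental_form g J))) [X, Y, Z, W] = 0"
proof -
  have J: "form_pullback J (ce_diff br (fundamental_form g J)) [X, Y, Z] =
      p X * (S Y Z + snd Y * K Z - snd Z * K Y)
    + p Y * (S Z X + snd Z * K X - snd X * K Z)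
    + p Z * (S X Y + snd X * K Y - snd Y * K X)" for X Y Z
    unfolding form_pullback_def list.map d_fundamental_form J_J S_J J K_minus
    by (simp add: algebra_simps)
  \<comment> \<open>This exchange is instantiated below only for pairs in the order
    \<open>X\<close>, \<open>Y\<close>, \<open>Z\<close>, \<open>W\<close>, so that one
    representative of \<open>S (F X) Y\<close> and \<open>S (F Y) X\<close> survives and the
    rewriting ends.\<close>
  have SF: "S (F X) Y = S (F Y) X - a * S X Y + p X * \<psi> Y - p Y * \<psi> X" for X Y
    using S_F[OF assms, of X Y] S_flip[of X "F Y"] by simp
  have Sb: "S Z (br X Y) = - snd X * S (F Y) Z + snd Y * S (F X) Z" for X Y Z
    using S_flip[of Z "br X Y"] S_br[of X Y Z] by simp
  show ?thesis
    unfolding ce_diff_4 J bracket_simps K_br S_br Sb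
    unfolding SF[of X Y] SF[of X Z] SF[of X W] SF[of Y Z] SF[of Y W] SF[of Z W]
      S_flip[of X Y] S_flip[of X Z] S_flip[of X W] S_flip[of Y Z] S_flip[of Y W] S_flip[of Z W]
    by (simp add: lin_simps c_f algebra_simps)
qed

end

lemma (in normal_form) ex_skt_structure:
  assumes "\<And>i. i < k \<Longrightarrow> Re (z i) \<in> {0, - a / 2}"
  shows "\<exists>g J. skt_structure (almost_abelian_bracket f) g J"
  unfolding skt_structure_iff
  using inner_product_g linear_J J_J g_J integrable pluriclosed[OF assms] by blast

section \<open>Similarity over the complex numbers in terms of coordinate functionals\<close>

text \<open>The second conjunct is injectivity on the complexification: \<open>u\<close> and
  \<open>v\<close> are the real and imaginary parts of a complex vector, on which the functionals
  are extended complex linearly.\<close>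

definition complex_coords :: "(nat \<Rightarrow> real ^ 'm \<Rightarrow> complex) \<Rightarrow> bool" where
  "complex_coords \<phi> \<longleftrightarrow> (\<forall>k<CARD('m). linear (\<phi> k)) \<and>
     (\<forall>u v. (\<forall>k<CARD('m). \<phi> k u + \<i> * \<phi> k v = 0) \<longrightarrow> u = 0 \<and> v = 0)"

definition coords_mat :: "(nat \<Rightarrow> real ^ 'm \<Rightarrow> complex) \<Rightarrow> complex mat" where
  "coords_mat \<phi> = Matrix.mat CARD('m) CARD('m) (\<lambda>(k, j). \<phi> k (axis (from_nat_into UNIV j) 1))"

lemma coords_mat_carrier [simp]:
  "coords_mat (\<phi> :: nat \<Rightarrow> real ^ 'm \<Rightarrow> complex) \<in> carrier_mat CARD('m) CARD('m)"
  "dim_row (coords_mat \<phi>) = CARD('m)" "dim_col (coords_mat \<phi>) = CARD('m)"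
  by (simp_all add: coords_mat_def)

lemma sum_enumeration:
  "(\<Sum>j<CARD('m). h (from_nat_into (UNIV :: 'm::finite set) j)) = (\<Sum>i\<in>UNIV. h i)"
  by (rule sum.reindex_bij_betw[OF bij_betw_enumeration])

lemma linear_axis_expansion:
  fixes \<phi> :: "real ^ 'm \<Rightarrow> complex"
  assumes "linear \<phi>"
  shows "\<phi> v = (\<Sum>j<CARD('m). \<phi> (axis (from_nat_into UNIV j) 1) * of_real (vec_nth v (from_nat_into UNIV j)))"
proof -
  have "\<phi> v = \<phi> (\<Sum>i\<in>UNIV. vec_nth v i *\<^sub>R axis i 1)"
    by (simp add: basis_expansion flip: scalar_mult_eq_scaleR)
  also have "\<dots> = (\<Sum>i\<in>UNIV. \<phi> (axis i 1) * of_real (vec_nth v i))"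
    by (simp add: linear_sum[OF assms] linear_scale[OF assms])
      (simp add: scaleR_conv_of_real[where 'a=complex] mult.commute)
  finally show ?thesis
    by (simp add: sum_enumeration[of "\<lambda>i. \<phi> (axis i 1) * of_real (vec_nth v i)"])
qed

text \<open>Applied to the complex vector \<open>cv u v\<close> with real part \<open>u\<close> and
  imaginary part \<open>v\<close>, the matrix lists the values of the extended functionals; a common
  zero is therefore a kernel vector.\<close>

lemma complex_coords_iff_det:
  fixes \<phi> :: "nat \<Rightarrow> real ^ 'm \<Rightarrow> complex"
  assumes lin: "\<And>k. k < CARD('m) \<Longrightarrow> linear (\<phi> k)"
  shows "complex_coords \<phi> \<longleftrightarrow> Determinant.det (coords_mat \<phi>) \<noteq> 0"
proof -
  let ?e = "from_nat_into (UNIV :: 'm set)"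
  define N where "N = CARD('m)"
  define cv where "cv u v = Matrix.vec N (\<lambda>j. of_real (vec_nth u (?e j)) + \<i> * of_real (vec_nth v (?e j)))"
    for u v :: "real ^ 'm"
  have cv_carrier: "cv u v \<in> carrier_vec N" for u v
    by (simp add: cv_def)
  have mult: "coords_mat \<phi> *\<^sub>v cv u v = Matrix.vec N (\<lambda>k. \<phi> k u + \<i> * \<phi> k v)" for u v
  proof (rule eq_vecI)
    fix k assume k: "k < dim_vec (Matrix.vec N (\<lambda>k. \<phi> k u + \<i> * \<phi> k v))"
    then have "k < N" by simp
    then have "vec_index (coords_mat \<phi> *\<^sub>v cv u v) k
      = (\<Sum>j<N. \<phi> k (axis (?e j) 1) * (of_real (vec_nth u (?e j)) + \<i> * of_real (vec_nth v (?e j))))"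
      by (simp add: coords_mat_def cv_def scalar_prod_def N_def[symmetric] lessThan_atLeast0)
    also have "\<dots> = \<phi> k u + \<i> * \<phi> k v"
      using linear_axis_expansion[OF lin, of k u] linear_axis_expansion[OF lin, of k v] \<open>k < N\<close>
      by (simp add: N_def sum.distrib algebra_simps sum_distrib_left)
    finally show "vec_index (coords_mat \<phi> *\<^sub>v cv u v) k = vec_index (Matrix.vec N (\<lambda>k. \<phi> k u + \<i> * \<phi> k v)) k"
      using \<open>k < N\<close> by simp
  qed (simp add: N_def)
  have bij: "bij_betw ?e {..<N} UNIV"
    unfolding N_def by (rule bij_betw_enumeration)
  have cv_0: "cv u v = 0\<^sub>v N \<longleftrightarrow> u = 0 \<and> v = 0" for u v
  proof -
    have "cv u v = 0\<^sub>v N \<longleftrightarrow> (\<forall>j<N. vec_nth u (?e j) = 0 \<and> vec_nth v (?e j) = 0)"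
      by (auto simp: cv_def Matrix.vec_eq_iff complex_eq_iff)
    also have "\<dots> \<longleftrightarrow> (\<forall>i. vec_nth u i = 0 \<and> vec_nth v i = 0)"
      using bij by (metis (no_types, lifting) UNIV_I bij_betw_def imageE lessThan_iff)
    finally show ?thesis
      by (auto simp: Finite_Cartesian_Product.vec_eq_iff)
  qed
  have cv_surj: "\<exists>u v. x = cv u v" if "x \<in> carrier_vec N" for x
  proof -
    define idx where "idx = the_inv_into {..<N} ?e"
    have idx: "idx (?e i) = i" if "i < N" for i
      using bij that unfolding idx_def by (simp add: bij_betw_def the_inv_into_f_f)
    have "x = cv (\<chi> j. Re (vec_index x (idx j))) (\<chi> j. Im (vec_index x (idx j)))"
      using that by (auto simp: cv_def Matrix.vec_eq_iff idx complex_eq_iff)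
    then show ?thesis by blast
  qed
  have "Determinant.det (coords_mat \<phi>) = 0 \<longleftrightarrow> (\<exists>x. x \<in> carrier_vec N \<and> x \<noteq> 0\<^sub>v N \<and> coords_mat \<phi> *\<^sub>v x = 0\<^sub>v N)"
    by (rule det_0_iff_vec_prod_zero_field) (simp add: N_def)
  also have "\<dots> \<longleftrightarrow> (\<exists>u v. \<not> (u = 0 \<and> v = 0) \<and> Matrix.vec N (\<lambda>k. \<phi> k u + \<i> * \<phi> k v) = 0\<^sub>v N)"
    using cv_carrier cv_surj cv_0 mult by metis
  also have "\<dots> \<longleftrightarrow> (\<exists>u v. \<not> (u = 0 \<and> v = 0) \<and> (\<forall>k<N. \<phi> k u + \<i> * \<phi> k v = 0))"
    by (simp add: Matrix.vec_eq_iff)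
  finally show ?thesis
    using lin unfolding complex_coords_def N_def by blast
qed

text \<open>The entries in column \<open>j\<close> of the two products are the two sides of the
  equation at the basis vector number \<open>j\<close>, and linearity extends it to all
  vectors.\<close>

lemma coords_mat_intertwines:
  fixes f :: "real ^ 'm \<Rightarrow> real ^ 'm"
  assumes "linear f" and T: "T \<in> carrier_mat CARD('m) CARD('m)"
    and lin: "\<And>k. k < CARD('m) \<Longrightarrow> linear (\<phi> k)"
  shows "coords_mat \<phi> * complex_matrix f = T * coords_mat \<phi> \<longleftrightarrow>
    (\<forall>k<CARD('m). \<forall>v. \<phi> k (f v) = (\<Sum>l<CARD('m). T $$ (k, l) * \<phi> l v))"
proof -
  let ?e = "from_nat_into (UNIV :: 'm set)"
  define N where "N = CARD('m)"
  have L: "(coords_mat \<phi> * complex_matrix f) $$ (k, j) = \<phi> k (f (axis (?e j) 1))"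
    if "k < N" "j < N" for k j
    using that linear_axis_expansion[OF lin, of k "f (axis (?e j) 1)"]
    by (simp add: coords_mat_def complex_matrix_def N_def scalar_prod_def lessThan_atLeast0)
  have R: "(T * coords_mat \<phi>) $$ (k, j) = (\<Sum>l<N. T $$ (k, l) * \<phi> l (axis (?e j) 1))"
    if "k < N" "j < N" for k j
    using that T
    by (simp add: coords_mat_def N_def scalar_prod_def lessThan_atLeast0)
  have "coords_mat \<phi> * complex_matrix f = T * coords_mat \<phi> \<longleftrightarrow>
    (\<forall>k<N. \<forall>j<N. \<phi> k (f (axis (?e j) 1)) = (\<Sum>l<N. T $$ (k, l) * \<phi> l (axis (?e j) 1)))"
  proof -
    have "coords_mat \<phi> * complex_matrix f = T * coords_mat \<phi> \<longleftrightarrow>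
        (\<forall>k<N. \<forall>j<N. (coords_mat \<phi> * complex_matrix f) $$ (k, j) = (T * coords_mat \<phi>) $$ (k, j))"
      using T by (simp add: mat_eq_iff complex_matrix_def N_def)
    then show ?thesis
      by (simp add: L R cong: conj_cong)
  qed
  also have "\<dots> \<longleftrightarrow> (\<forall>k<N. \<forall>v. \<phi> k (f v) = (\<Sum>l<N. T $$ (k, l) * \<phi> l v))" (is "?A \<longleftrightarrow> ?B")
  proof (intro iffI allI impI)
    fix k v assume A: ?A and k: "k < N"
    have l1: "linear (\<lambda>v. \<phi> k (f v))"
      using linear_compose[OF \<open>linear f\<close> lin[of k]] k by (simp add: o_def N_def)
    have "linear (\<lambda>v. T $$ (k, l) * \<phi> l v)" if "l < N" for l
      using linear_compose[OF lin[of l] linear_times[of "T $$ (k, l)"]] that by (simp add: o_def N_def)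
    then have l2: "linear (\<lambda>v. \<Sum>l<N. T $$ (k, l) * \<phi> l v)"
      by (intro linear_compose_sum) auto
    show "\<phi> k (f v) = (\<Sum>l<N. T $$ (k, l) * \<phi> l v)"
      unfolding linear_axis_expansion[OF l1, of v] linear_axis_expansion[OF l2, of v]
      using A k by (simp add: N_def)
  qed auto
  finally show ?thesis
    unfolding N_def .
qed

text \<open>A similarity \<open>A = P * T * Q\<close> amounts to an invertible \<open>Q\<close> with
  \<open>Q * A = T * Q\<close>; the rows of \<open>Q\<close> are the coordinate functionals.\<close>

lemma similar_complex_matrix_iff:
  fixes f :: "real ^ 'm \<Rightarrow> real ^ 'm"
  assumes f: "linear f" and T: "T \<in> carrier_mat CARD('m) CARD('m)"
  shows "similar_mat (complex_matrix f) T \<longleftrightarrow>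
    (\<exists>\<phi>. complex_coords \<phi> \<and> (\<forall>k<CARD('m). \<forall>v. \<phi> k (f v) = (\<Sum>l<CARD('m). T $$ (k, l) * \<phi> l v)))"
proof
  let ?e = "from_nat_into (UNIV :: 'm set)"
  define N where "N = CARD('m)"
  have A: "complex_matrix f \<in> carrier_mat N N"
    by (simp add: complex_matrix_def N_def)
  {
    assume "similar_mat (complex_matrix f) T"
    then obtain P Q where "similar_mat_wit (complex_matrix f) T P Q"
      unfolding similar_mat_def by blast
    from similar_mat_witD2[OF A this]
    have PQ: "P \<in> carrier_mat N N" "Q \<in> carrier_mat N N" "P * Q = 1\<^sub>m N" "Q * P = 1\<^sub>m N"
      "complex_matrix f = P * T * Q"
      by auto
    define \<phi> where "\<phi> k v = (\<Sum>j<N. Q $$ (k, j) * of_real (vec_nth v (?e j)))" for k v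
    have lin: "linear (\<phi> k)" for k
      by (rule linearI)
        (auto simp: \<phi>_def algebra_simps sum.distrib scaleR_conv_of_real[where 'a=complex] sum_distrib_left)
    have "coords_mat \<phi> = Q"
    proof (rule eq_matI)
      fix k j assume kj: "k < dim_row Q" "j < dim_col Q"
      then have "k < N" "j < N" using PQ by auto
      have "?e i = ?e j \<longleftrightarrow> i = j" if "i < N" for i
        using bij_betw_enumeration[where 'm='m] that \<open>j < N\<close>
        by (auto simp: bij_betw_def inj_on_def N_def)
      then have "\<phi> k (axis (?e j) 1) = (\<Sum>i<N. if i = j then Q $$ (k, i) else 0)"
        unfolding \<phi>_def by (intro sum.cong) (auto simp: axis_def)
      then show "coords_mat \<phi> $$ (k, j) = Q $$ (k, j)"
        using \<open>k < N\<close> \<open>j < N\<close> by (simp add: coords_mat_def N_def[symmetric])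
    qed (use PQ in \<open>auto simp: N_def\<close>)
    moreover have "Q * complex_matrix f = T * Q"
    proof -
      have T': "T \<in> carrier_mat N N" using T by (simp add: N_def)
      have "Q * complex_matrix f = Q * P * (T * Q)"
        unfolding PQ(5) using PQ(1,2) T' by (simp add: assoc_mult_mat[of _ N N _ N _ N])
      then show ?thesis
        using PQ T' by simp
    qed
    moreover have "Determinant.det Q \<noteq> 0"
      using det_mult[OF PQ(1,2)] PQ(3) by auto
    ultimately show "\<exists>\<phi>. complex_coords \<phi> \<and> (\<forall>k<CARD('m). \<forall>v. \<phi> k (f v) = (\<Sum>l<CARD('m). T $$ (k, l) * \<phi> l v))"
      using complex_coords_iff_det[of \<phi>] coords_mat_intertwines[OF f T, of \<phi>] lin by auto
  }
  {
    assume "\<exists>\<phi>. complex_coords \<phi> \<and> (\<forall>k<CARD('m). \<forall>v. \<phi> k (f v) = (\<Sum>l<CARD('m). T $$ (k, l) * \<phi> l v))"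
    then obtain \<phi> :: "nat \<Rightarrow> real ^ 'm \<Rightarrow> complex" where \<phi>: "complex_coords \<phi>" "\<forall>k<CARD('m). \<forall>v. \<phi> k (f v) = (\<Sum>l<CARD('m). T $$ (k, l) * \<phi> l v)"
      by blast
    then have lin: "linear (\<phi> k)" if "k < CARD('m)" for k
      using that by (simp add: complex_coords_def)
    define Q where "Q = coords_mat \<phi>"
    have Q: "Q \<in> carrier_mat N N" "Q * complex_matrix f = T * Q" "Determinant.det Q \<noteq> 0"
      using complex_coords_iff_det[OF lin] coords_mat_intertwines[OF f T lin] \<phi>
      by (auto simp: Q_def N_def)
    from det_non_zero_imp_unit[OF Q(1,3), unfolded Units_def, of "()"]
    obtain P where P: "P \<in> carrier_mat N N" "P * Q = 1\<^sub>m N" "Q * P = 1\<^sub>m N"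
      by (auto simp: ring_mat_def)
    have T': "T \<in> carrier_mat N N" using T by (simp add: N_def)
    have "complex_matrix f = P * Q * complex_matrix f"
      using A P by simp
    also have "\<dots> = P * (Q * complex_matrix f)"
      by (rule assoc_mult_mat[OF P(1) Q(1) A])
    also have "\<dots> = P * T * Q"
      unfolding Q(2) by (rule assoc_mult_mat[OF P(1) T' Q(1), symmetric])
    finally have "similar_mat_wit (complex_matrix f) T P Q"
      using P Q T' A by (intro similar_mat_witI[of _ _ N])
    then show "similar_mat (complex_matrix f) T"
      unfolding similar_mat_def by blast
  }
qed

text \<open>
  Averaging each coordinate with the conjugate of its partner makes the family stable under
  conjugation. The determinant of the averaged family is, up to a unit, a nonzero polynomial in
  \<open>cnj u / u\<close>, so that a suitable phase \<open>u\<close> keeps the family independent.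
\<close>

lemma complex_coords_conjugate_average:
  fixes \<phi> :: "nat \<Rightarrow> real ^ 'm \<Rightarrow> complex"
  assumes \<phi>: "complex_coords \<phi>" and \<sigma>: "\<And>k. k < CARD('m) \<Longrightarrow> \<sigma> k < CARD('m)"
  shows "\<exists>u. complex_coords (\<lambda>k v. u * \<phi> k v + cnj u * cnj (\<phi> (\<sigma> k) v))"
proof -
  define N where "N = CARD('m)"
  have lin: "linear (\<phi> k)" if "k < N" for k
    using that \<phi> by (simp add: complex_coords_def N_def)
  define \<phi>' where "\<phi>' k v = cnj (\<phi> (\<sigma> k) v)" for k v
  \<comment> \<open>The entries are linear polynomials. At 0 only \<open>\<phi>\<close> remains, so
    the determinant is a nonzero polynomial; at \<open>cnj u / u\<close> the matrix is, up to the
    factor \<open>u\<close>, that of the averaged family.\<close>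
  define M where "M = Matrix.mat N N (\<lambda>ij. [: coords_mat \<phi> $$ ij, coords_mat \<phi>' $$ ij :])"
  have poly_M: "poly (Determinant.det M) c =
      Determinant.det (Matrix.mat N N (\<lambda>ij. coords_mat \<phi> $$ ij + c * coords_mat \<phi>' $$ ij))" for c
  proof -
    have hom: "comm_ring_hom (\<lambda>p. poly p c)"
      by unfold_locales auto
    have "poly (Determinant.det M) c = Determinant.det (map_mat (\<lambda>p. poly p c) M)"
      by (rule comm_ring_hom.hom_det[OF hom, symmetric])
    also have "map_mat (\<lambda>p. poly p c) M = Matrix.mat N N (\<lambda>ij. coords_mat \<phi> $$ ij + c * coords_mat \<phi>' $$ ij)"
      by (auto simp: M_def)
    finally show ?thesis .
  qed
  have "Matrix.mat N N (\<lambda>ij. coords_mat \<phi> $$ ij + 0 * coords_mat \<phi>' $$ ij) = coords_mat \<phi>"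
    by (auto simp: N_def)
  then have "poly (Determinant.det M) 0 \<noteq> 0"
    using complex_coords_iff_det[of \<phi>] \<phi> lin poly_M[of 0] by (simp add: N_def)
  then have "finite {c. poly (Determinant.det M) c = 0}"
    by (intro poly_roots_finite) auto
  moreover have "infinite (sphere (0::complex) 1)"
  proof
    assume "finite (sphere (0::complex) 1)"
    moreover have "(\<lambda>x. Complex x (sqrt (1 - x\<^sup>2))) ` {0..1} \<subseteq> sphere 0 1"
      by (auto simp: cmod_def power_le_one)
    ultimately have "finite ((\<lambda>x. Complex x (sqrt (1 - x\<^sup>2))) ` {0..1})"
      by (rule finite_subset[rotated])
    then have "finite {0..1::real}"
      by (rule finite_imageD) (auto intro: inj_onI)
    then show False
      using infinite_Icc[of 0 "1::real"] by simp
  qed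
  ultimately obtain c where c: "cmod c = 1" "poly (Determinant.det M) c \<noteq> 0"
    by (metis (mono_tags, lifting) mem_Collect_eq mem_sphere_0 rev_finite_subset subsetI)
  \<comment> \<open>For \<open>c\<close> on the unit circle this phase satisfies
    \<open>cnj u / u = c\<close>.\<close>
  define u where "u = cnj (csqrt c)"
  have u: "u \<noteq> 0" "cnj u = c * u"
  proof -
    have n: "cmod (csqrt c) = 1"
      using c(1) by simp
    then show "u \<noteq> 0"
      by (auto simp: u_def)
    have "c * u = csqrt c * (csqrt c * cnj (csqrt c))"
      by (simp add: u_def flip: mult.assoc power2_eq_square)
    also have "\<dots> = cnj u"
      unfolding complex_norm_square[symmetric] n by (simp add: u_def)
    finally show "cnj u = c * u" ..
  qed
  define \<psi> where "\<psi> k v = u * \<phi> k v + cnj u * cnj (\<phi> (\<sigma> k) v)" for k v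
  have "linear (\<psi> k)" if "k < N" for k
    using linear_add[OF lin[OF that]] linear_scale[OF lin[OF that]]
      linear_add[OF lin, of "\<sigma> k"] linear_scale[OF lin, of "\<sigma> k"] \<sigma> that
    by (intro linearI) (auto simp: \<psi>_def N_def algebra_simps)
  moreover have "coords_mat \<psi> = u \<cdot>\<^sub>m Matrix.mat N N (\<lambda>ij. coords_mat \<phi> $$ ij + c * coords_mat \<phi>' $$ ij)"
    by (rule eq_matI) (auto simp: N_def coords_mat_def \<psi>_def \<phi>'_def u algebra_simps)
  then have "Determinant.det (coords_mat \<psi>) \<noteq> 0"
    using c(2) u(1) by (simp add: det_smult poly_M)
  ultimately have "complex_coords \<psi>"
    using complex_coords_iff_det[of \<psi>] by (simp add: N_def)
  then show ?thesis
    unfolding \<psi>_def by blast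
qed

section \<open>Spectral coordinates: one real functional and conjugate pairs\<close>

text \<open>The index layout of \<open>spectral_coords\<close>: 0 belongs to the real eigenvalue,
  \<open>2 * i + 1\<close> and \<open>2 * i + 2\<close> to the pair number \<open>i\<close>.\<close>

lemma all_less_odd_iff: "(\<forall>j<2 * k + 1. P j) \<longleftrightarrow> P 0 \<and> (\<forall>i<k. P (2 * i + 1) \<and> P (2 * i + 2 :: nat))"
proof (intro iffI conjI allI impI; (elim conjE)?)
  fix j assume *: "P 0" "\<forall>i<k. P (2 * i + 1) \<and> P (2 * i + 2)" "j < 2 * k + 1"
  consider "j = 0" | i where "j = 2 * i + 1" | i where "j = 2 * i + 2"
    by (metis One_nat_def Suc_eq_plus1 add_2_eq_Suc' mult_Suc_right evenE oddE not0_implies_Suc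
        add.commute mult_0_right)
  then show "P j"
    by cases (use * in auto)
qed auto

text \<open>Complex counterpart of \<open>normal_form\<close>: the two members of a pair obey
  conjugate equations but need not be conjugate functionals.\<close>

definition spectral_coords ::
    "(real ^ 'm \<Rightarrow> real ^ 'm) \<Rightarrow> nat \<Rightarrow> real \<Rightarrow> (nat \<Rightarrow> complex) \<Rightarrow> (nat \<Rightarrow> complex) \<Rightarrow>
     (nat \<Rightarrow> real ^ 'm \<Rightarrow> complex) \<Rightarrow> bool" where
  "spectral_coords f k a z w \<phi> \<longleftrightarrow> complex_coords \<phi> \<and>
     (\<forall>v. \<phi> 0 (f v) = of_real a * \<phi> 0 v) \<and>
     (\<forall>i<k. \<forall>v.
        \<phi> (2 * i + 1) (f v) = z i * \<phi> (2 * i + 1) v + w i * \<phi> 0 v \<and>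
        \<phi> (2 * i + 2) (f v) = cnj (z i) * \<phi> (2 * i + 2) v + cnj (w i) * \<phi> 0 v)"

text \<open>As \<open>a\<close> is real, the equations survive conjugating all functionals and
  exchanging the members of each pair by \<open>\<sigma>\<close>. Averaging over this involution
  keeps them, makes the functional at 0 real and makes the pairs conjugate.\<close>

lemma spectral_coords_imp_normal_form:
  fixes f :: "real ^ 'm \<Rightarrow> real ^ 'm"
  assumes "linear f" and card: "CARD('m) = 2 * k + 1" and \<phi>: "spectral_coords f k a z w \<phi>"
  shows "\<exists>c \<zeta>. normal_form f k a z w c \<zeta>"
proof -
  define \<sigma> where "\<sigma> j = (if j = 0 then 0 else if odd j then j + 1 else j - 1)" for j :: nat
  have \<sigma>: "\<sigma> j < CARD('m)" if "j < CARD('m)" for j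
    using that card by (auto simp: \<sigma>_def elim!: oddE)
  have coords: "complex_coords \<phi>"
    using \<phi> by (simp add: spectral_coords_def)
  obtain u where u: "complex_coords (\<lambda>k v. u * \<phi> k v + cnj u * cnj (\<phi> (\<sigma> k) v))"
    using complex_coords_conjugate_average[of \<phi> \<sigma>] coords \<sigma> by blast
  define \<psi> where "\<psi> j v = u * \<phi> j v + cnj u * cnj (\<phi> (\<sigma> j) v)" for j v
  have \<psi>: "complex_coords \<psi>"
    using u unfolding \<psi>_def .
  then have lin: "linear (\<psi> j)" if "j < CARD('m)" for j
    using that by (simp add: complex_coords_def)
  have \<psi>_0: "\<psi> 0 v = of_real (Re (\<psi> 0 v))" for v
    by (simp add: \<psi>_def \<sigma>_def complex_eq_iff)
  have \<psi>_even: "\<psi> (2 * i + 2) v = cnj (\<psi> (2 * i + 1) v)" for i v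
    by (simp add: \<psi>_def \<sigma>_def)
  have f0: "\<psi> 0 (f v) = of_real a * \<psi> 0 v" for v
    using \<phi> by (simp add: \<psi>_def \<sigma>_def spectral_coords_def algebra_simps)
  have f1: "\<psi> (2 * i + 1) (f v) = z i * \<psi> (2 * i + 1) v + w i * \<psi> 0 v" if "i < k" for i v
    using \<phi> that by (simp add: \<psi>_def \<sigma>_def spectral_coords_def algebra_simps)
  have "normal_form f k a z w (\<lambda>v. Re (\<psi> 0 v)) (\<lambda>i. \<psi> (2 * i + 1))"
  proof (rule normal_form.intro)
    show "linear f" "CARD('m) = 2 * k + 1"
      by fact+
    show "linear (\<lambda>v. Re (\<psi> 0 v))"
      using linear_add[OF lin[of 0]] linear_scale[OF lin[of 0]] card by (intro linearI) auto
    show "linear (\<psi> (2 * i + 1))" if "i < k" for i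
      using lin that card by simp
    show "Re (\<psi> 0 (f v)) = a * Re (\<psi> 0 v)" for v
      by (simp add: f0)
    show "\<psi> (2 * i + 1) (f v) = z i * \<psi> (2 * i + 1) v + w i * of_real (Re (\<psi> 0 v))" if "i < k" for i v
      using f1[OF that] \<psi>_0 by metis
    fix v assume v: "Re (\<psi> 0 v) = 0" "\<And>i. i < k \<Longrightarrow> \<psi> (2 * i + 1) v = 0"
    have "\<forall>j<2 * k + 1. \<psi> j v = 0"
      unfolding all_less_odd_iff \<psi>_even using v \<psi>_0[of v] by simp
    then have "\<psi> j v + \<i> * \<psi> j 0 = 0" if "j < CARD('m)" for j
      using that card linear_0[OF lin[of j]] by simp
    then show "v = 0"
      using \<psi> unfolding complex_coords_def by blast
  qed
  then show ?thesis by blast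
qed

lemma (in normal_form) ex_spectral_coords: "\<exists>\<phi>. spectral_coords f k a z w \<phi>"
proof -
  define \<phi> where "\<phi> j v = (if j = 0 then of_real (c v) else if odd j then \<zeta> (j div 2) v
    else cnj (\<zeta> (j div 2 - 1) v))" for j v
  have \<phi>: "\<phi> 0 = (\<lambda>v. of_real (c v))" "\<phi> (2 * i + 1) = \<zeta> i" "\<phi> (2 * i + 2) = (\<lambda>v. cnj (\<zeta> i v))" for i
    by (auto simp: \<phi>_def)
  have "linear (\<lambda>v. complex_of_real (c v))"
    by (rule linearI) (simp_all add: lin_simps scaleR_conv_of_real[where 'a=complex])
  moreover have "linear (\<lambda>v. cnj (\<zeta> i v))" if "i < k" for i
    by (rule linearI) (simp_all add: lin_simps that scaleR_conv_of_real[where 'a=complex])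
  ultimately have "\<forall>j<CARD('m). linear (\<phi> j)"
    unfolding card all_less_odd_iff \<phi> using lin_\<zeta> by simp
  moreover have "u = 0 \<and> v = 0" if "\<forall>j<CARD('m). \<phi> j u + \<i> * \<phi> j v = 0" for u v
  proof -
    have *: "of_real (c u) + \<i> * of_real (c v) = 0"
      "\<forall>i<k. \<zeta> i u + \<i> * \<zeta> i v = 0 \<and> cnj (\<zeta> i u) + \<i> * cnj (\<zeta> i v) = 0"
      using that unfolding card all_less_odd_iff \<phi> by auto
    then show ?thesis
      by (intro conjI kernel) (auto simp: complex_eq_iff)
  qed
  ultimately have "complex_coords \<phi>"
    unfolding complex_coords_def by blast
  moreover have "\<phi> 0 (f v) = of_real a * \<phi> 0 v" for v
    unfolding \<phi> by (simp add: c_f)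
  moreover have "\<phi> (2 * i + 1) (f v) = z i * \<phi> (2 * i + 1) v + w i * \<phi> 0 v"
    "\<phi> (2 * i + 2) (f v) = cnj (z i) * \<phi> (2 * i + 2) v + cnj (w i) * \<phi> 0 v" if "i < k" for i v
    unfolding \<phi> using that by (simp_all add: \<zeta>_f)
  ultimately show ?thesis
    unfolding spectral_coords_def by blast
qed

section \<open>Diagonalizability in terms of coordinates\<close>

lemma complex_coords_permute:
  fixes \<phi> :: "nat \<Rightarrow> real ^ 'm \<Rightarrow> complex"
  assumes "complex_coords \<phi>" "p permutes {..<CARD('m)}"
  shows "complex_coords (\<phi> \<circ> p)"
proof -
  have "(\<forall>k<CARD('m). P (p k)) \<longleftrightarrow> (\<forall>k<CARD('m). P k)" for P
    using permutes_image[OF assms(2)] by (metis (no_types, lifting) image_iff lessThan_iff)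
  from this[of "\<lambda>k. linear (\<phi> k)"] this[of "\<lambda>k. \<phi> k u + \<i> * \<phi> k v = 0" for u v]
  show ?thesis
    using assms(1) unfolding complex_coords_def by simp
qed

lemma proots_char_poly_upper_triangular:
  fixes D :: "complex mat"
  assumes "D \<in> carrier_mat N N" "upper_triangular D"
  shows "proots (char_poly D) = mset (diag_mat D)"
proof -
  have "proots (\<Prod>a\<leftarrow>xs. [:- a, 1:]) = mset xs" for xs :: "complex list"
  proof (induction xs)
    case (Cons x xs)
    have "(\<Prod>a\<leftarrow>xs. [:- a, 1:]) \<noteq> 0"
      by (auto simp: prod_list_zero_iff)
    then have "proots (\<Prod>a\<leftarrow>x # xs. [:- a, 1:]) = proots [:- x, 1:] + proots (\<Prod>a\<leftarrow>xs. [:- a, 1:])"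
      unfolding list.map prod_list.Cons by (intro proots_mult) auto
    then show ?case
      using Cons by simp
  qed simp
  then show ?thesis
    by (simp add: char_poly_upper_triangular[OF assms])
qed

text \<open>The roots of the characteristic polynomial are the diagonal entries with multiplicity,
  so \<open>ds\<close> is a permutation of the diagonal; permuting the eigenfunctionals accordingly
  puts them in the order of \<open>ds\<close>.\<close>

lemma diagonalizable_mat_iff_coords:
  fixes f :: "real ^ 'm \<Rightarrow> real ^ 'm"
  assumes f: "linear f"
  shows "diagonalizable_mat (complex_matrix f) \<and> proots (char_poly (complex_matrix f)) = mset ds \<longleftrightarrow>
    length ds = CARD('m) \<and> (\<exists>\<phi>. complex_coords \<phi> \<and> (\<forall>k<CARD('m). \<forall>v. \<phi> k (f v) = ds ! k * \<phi> k v))"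
    (is "?L \<longleftrightarrow> ?R")
proof
  define N where "N = CARD('m)"
  have A: "complex_matrix f \<in> carrier_mat N N"
    by (simp add: complex_matrix_def N_def)
  {
    assume ?L
    then obtain D where D: "diagonal_mat D" "similar_mat (complex_matrix f) D"
      and ds: "proots (char_poly (complex_matrix f)) = mset ds"
      unfolding diagonalizable_mat_def by blast
    have DN: "D \<in> carrier_mat N N"
      using similar_matD[OF D(2)] A by auto
    have "upper_triangular D"
      using D(1) DN by (auto simp: diagonal_mat_def)
    then have mset: "mset ds = mset (diag_mat D)"
      using proots_char_poly_upper_triangular[OF DN] char_poly_similar[OF D(2)] ds by simp
    have len: "length (diag_mat D) = N"
      using DN by (simp add: diag_mat_def)
    obtain p where p: "p permutes {..<N}" "permute_list p (diag_mat D) = ds"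
      using mset_eq_permutation[OF mset] len by auto
    obtain \<phi> :: "nat \<Rightarrow> real ^ 'm \<Rightarrow> complex" where \<phi>: "complex_coords \<phi>"
      "\<forall>k<N. \<forall>v. \<phi> k (f v) = (\<Sum>l<N. D $$ (k, l) * \<phi> l v)"
      using similar_complex_matrix_iff[OF f, of D] DN D(2) unfolding N_def by blast
    have "\<phi> (p k) (f v) = ds ! k * \<phi> (p k) v" if "k < N" for k v
    proof -
      have pk: "p k < N"
        using permutes_in_image[OF p(1), of k] that by simp
      have "\<phi> (p k) (f v) = (\<Sum>l<N. D $$ (p k, l) * \<phi> l v)"
        using \<phi>(2) pk by blast
      also have "\<dots> = (\<Sum>l<N. if l = p k then D $$ (p k, p k) * \<phi> (p k) v else 0)"
        using D(1) DN pk by (intro sum.cong) (auto simp: diagonal_mat_def)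
      also have "\<dots> = D $$ (p k, p k) * \<phi> (p k) v"
        using pk by simp
      also have "D $$ (p k, p k) = ds ! k"
        using p that pk DN len by (auto simp: permute_list_nth diag_mat_def)
      finally show ?thesis .
    qed
    moreover have "length ds = N"
      using len mset mset_eq_length by metis
    ultimately show ?R
      using complex_coords_permute[OF \<phi>(1)] p(1) unfolding N_def by (auto intro!: exI[of _ "\<phi> \<circ> p"])
  }
  {
    assume R: ?R
    then obtain \<phi> :: "nat \<Rightarrow> real ^ 'm \<Rightarrow> complex" where \<phi>: "complex_coords \<phi>" "\<forall>k<N. \<forall>v. \<phi> k (f v) = ds ! k * \<phi> k v"
      unfolding N_def by blast
    define D where "D = Matrix.mat N N (\<lambda>(i, j). if i = j then ds ! i else 0)"
    have D: "diagonal_mat D" "D \<in> carrier_mat N N" "upper_triangular D" "diag_mat D = ds"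
      using R by (auto simp: D_def diagonal_mat_def diag_mat_def N_def intro: nth_equalityI)
    have "(\<Sum>l<N. D $$ (k, l) * \<phi> l v) = (\<Sum>l<N. if l = k then ds ! k * \<phi> k v else 0)" if "k < N" for k v
      using that by (intro sum.cong) (auto simp: D_def)
    then have "similar_mat (complex_matrix f) D"
      using similar_complex_matrix_iff[OF f, of D] D(2) \<phi> unfolding N_def by auto
    then show ?L
      using D proots_char_poly_upper_triangular[OF D(2,3)] char_poly_similar[of "complex_matrix f" D]
      unfolding diagonalizable_mat_def by auto
  }
qed

lemma length_concat_pairs: "length (concat (map (\<lambda>x. [g x, h x]) xs)) = 2 * length xs"
  by (induction xs) auto

lemma nth_concat_pairs:
  assumes "i < length xs"
  shows "concat (map (\<lambda>x. [g x, h x]) xs) ! (2 * i) = g (xs ! i)"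
    and "concat (map (\<lambda>x. [g x, h x]) xs) ! (2 * i + 1) = h (xs ! i)"
  using assms by (induction xs arbitrary: i) (auto simp: nth_Cons split: nat.splits)

text \<open>For \<open>w = 0\<close> the equations of \<open>spectral_coords\<close> say that all
  functionals are eigenfunctionals, with the eigenvalues listed as \<open>a\<close> followed by the
  pairs \<open>z\<close>, \<open>cnj z\<close>.\<close>

lemma diagonalizable_iff_spectral_coords:
  fixes f :: "real ^ 'm \<Rightarrow> real ^ 'm"
  assumes f: "linear f" and card: "CARD('m) = 2 * k + 1"
  shows "diagonalizable_mat (complex_matrix f) \<and>
     (\<exists>(a::real) (zs::complex list). length zs = k \<and>
        proots (char_poly (complex_matrix f)) =
          mset (complex_of_real a # concat (map (\<lambda>z. [z, cnj z]) zs)) \<and>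
        (\<forall>z\<in>set zs. Re z \<in> {0, - a / 2})) \<longleftrightarrow>
   (\<exists>a z \<phi>. spectral_coords f k a z (\<lambda>_. 0) \<phi> \<and> (\<forall>i<k. Re (z i) \<in> {0, - a / 2}))"
proof -
  have *: "diagonalizable_mat (complex_matrix f) \<and>
      proots (char_poly (complex_matrix f)) =
        mset (complex_of_real a # concat (map (\<lambda>z. [z, cnj z]) zs)) \<longleftrightarrow>
    (\<exists>\<phi>. spectral_coords f k a (\<lambda>i. zs ! i) (\<lambda>_. 0) \<phi>)" if "length zs = k" for zs a
    unfolding diagonalizable_mat_iff_coords[OF f] spectral_coords_def card all_less_odd_iff
    using that nth_concat_pairs[of _ zs "\<lambda>z. z" cnj]
    by (auto simp: length_concat_pairs)
  show ?thesis
  proof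
    assume "diagonalizable_mat (complex_matrix f) \<and>
     (\<exists>(a::real) (zs::complex list). length zs = k \<and>
        proots (char_poly (complex_matrix f)) =
          mset (complex_of_real a # concat (map (\<lambda>z. [z, cnj z]) zs)) \<and>
        (\<forall>z\<in>set zs. Re z \<in> {0, - a / 2}))"
    then obtain a zs where "length zs = k" "\<exists>\<phi>. spectral_coords f k a (\<lambda>i. zs ! i) (\<lambda>_. 0) \<phi>"
       "\<forall>z\<in>set zs. Re z \<in> {0, - a / 2}"
      using * by blast
    then show "\<exists>a z \<phi>. spectral_coords f k a z (\<lambda>_. 0) \<phi> \<and> (\<forall>i<k. Re (z i) \<in> {0, - a / 2})"
      by (metis nth_mem)
  next
    assume "\<exists>a z \<phi>. spectral_coords f k a z (\<lambda>_. 0) \<phi> \<and> (\<forall>i<k. Re (z i) \<in> {0, - a / 2})"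
    then obtain a z \<phi> where \<phi>: "spectral_coords f k a z (\<lambda>_. 0) \<phi>" "\<forall>i<k. Re (z i) \<in> {0, - a / 2}"
      by blast
    define zs where "zs = map z [0..<k]"
    have "length zs = k" "\<forall>z\<in>set zs. Re z \<in> {0, - a / 2}"
      using \<phi>(2) by (auto simp: zs_def)
    moreover have "spectral_coords f k a (\<lambda>i. zs ! i) (\<lambda>_. 0) \<phi>"
      using \<phi>(1) by (simp add: spectral_coords_def zs_def)
    ultimately show "diagonalizable_mat (complex_matrix f) \<and>
     (\<exists>(a::real) (zs::complex list). length zs = k \<and>
        proots (char_poly (complex_matrix f)) =
          mset (complex_of_real a # concat (map (\<lambda>z. [z, cnj z]) zs)) \<and>
        (\<forall>z\<in>set zs. Re z \<in> {0, - a / 2}))"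
      using * by blast
  qed
qed

section \<open>The Jordan form with one block of size two\<close>

lemma jordan_matrix_size_1:
  "jordan_matrix (map (Pair 1) xs) =
     Matrix.mat (length xs) (length xs) (\<lambda>(i, j). if i = j then xs ! i else 0)"
proof (induction xs)
  case (Cons x xs)
  show ?case
    unfolding list.map jordan_matrix_Cons Cons
    by (rule eq_matI) (auto simp: sum_list_triv o_def nth_Cons' jordan_block_def)
qed (auto simp: jordan_matrix_def)

lemma jordan_matrix_size_2_1:
  "jordan_matrix ((2, x) # map (Pair 1) xs) =
     Matrix.mat (length xs + 2) (length xs + 2)
       (\<lambda>(i, j). if i = j then (x # x # xs) ! i else if i = 0 \<and> j = 1 then 1 else 0)"
  unfolding jordan_matrix_Cons jordan_matrix_size_1
  by (rule eq_matI) (auto simp: sum_list_triv o_def nth_Cons' jordan_block_def numeral_2_eq_2)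

text \<open>The superdiagonal entry of the block of size two yields the extra term
  \<open>\<phi> 1\<close> in row 0; a wrong length of \<open>xs\<close> is impossible because
  similar matrices have equal size.\<close>

lemma jordan_nf_iff_coords:
  fixes f :: "real ^ 'm \<Rightarrow> real ^ 'm" and xs :: "complex list"
  assumes f: "linear f"
  shows "jordan_nf (complex_matrix f) ((2, x) # map (Pair 1) xs) \<longleftrightarrow>
    length xs + 2 = CARD('m) \<and> (\<exists>\<phi>. complex_coords \<phi> \<and>
      (\<forall>k<CARD('m). \<forall>v. \<phi> k (f v) = (x # x # xs) ! k * \<phi> k v + (if k = 0 then \<phi> 1 v else 0)))"
proof (cases "length xs + 2 = CARD('m)")
  case True
  define N where "N = CARD('m)"
  have "(\<Sum>l<N. jordan_matrix ((2, x) # map (Pair 1) xs) $$ (k, l) * \<phi> l v)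
      = (x # x # xs) ! k * \<phi> k v + (if k = 0 then \<phi> 1 v else 0)" (is "?l = _") if "k < N"
    for k v and \<phi> :: "nat \<Rightarrow> real ^ 'm \<Rightarrow> complex"
  proof -
    have "?l = (\<Sum>l<N. (if l = k then (x # x # xs) ! k * \<phi> k v else 0) + (if l = 1 then if k = 0 then \<phi> 1 v else 0 else 0))"
      unfolding jordan_matrix_size_2_1 using that True
      by (intro sum.cong) (auto simp: N_def)
    then show ?thesis
      using that True by (simp add: sum.distrib N_def)
  qed
  moreover have "jordan_matrix ((2, x) # map (Pair 1) xs) \<in> carrier_mat N N"
    using True by (simp add: jordan_matrix_size_2_1 N_def del: One_nat_def)
  ultimately show ?thesis
    using similar_complex_matrix_iff[OF f, of "jordan_matrix ((2, x) # map (Pair 1) xs)"] True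
    by (auto simp: jordan_nf_def N_def)
next
  case False
  have "\<not> similar_mat (complex_matrix f) (jordan_matrix ((2, x) # map (Pair 1) xs))"
  proof
    assume "similar_mat (complex_matrix f) (jordan_matrix ((2, x) # map (Pair 1) xs))"
    then obtain n where n: "complex_matrix f \<in> carrier_mat n n"
      "jordan_matrix ((2, x) # map (Pair 1) xs) \<in> carrier_mat n n"
      by (blast dest: similar_matD)
    have "n = CARD('m)"
      using carrier_matD(1)[OF n(1)] by (simp add: complex_matrix_def)
    moreover have "n = length xs + 2"
      using carrier_matD(1)[OF n(2)] unfolding jordan_matrix_size_2_1 by simp
    ultimately show False
      using False by simp
  qed
  then show ?thesis
    using False by (simp add: jordan_nf_def)
qed

text \<open>Index 0 is reserved for the pair with eigenvalue 0 that absorbs the Jordan block, hence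
  the shift by one in \<open>bs\<close>.\<close>

definition jordan_eigenvalues :: "real list \<Rightarrow> nat \<Rightarrow> complex" where
  "jordan_eigenvalues bs i = (if i = 0 then 0 else \<i> * of_real (bs ! (i - 1)))"

lemma complex_sum_diff_eq_0D:
  fixes a b c d :: complex
  assumes "(a + \<i> * b) + \<i> * (c + \<i> * d) = 0" "(a - \<i> * b) + \<i> * (c - \<i> * d) = 0"
  shows "a + \<i> * c = 0" "b + \<i> * d = 0"
  using assms by (auto simp: complex_eq_iff)

text \<open>The block gives a chain in which \<open>f\<close> takes \<open>\<phi> 0\<close> to
  \<open>\<phi> 1\<close> and \<open>\<phi> 1\<close> to 0, and the last coordinate
  \<open>\<phi> (2 * k)\<close> is taken to 0. So \<open>\<phi> 1\<close> serves as the real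
  functional, and \<open>\<phi> 0 \<plusminus> \<i> * \<phi> (2 * k)\<close> are both taken to it: a
  pair with eigenvalue 0 and \<open>w = 1\<close>. The other pairs are only renumbered.\<close>

lemma jordan_nf_iff_spectral_coords:
  fixes f :: "real ^ 'm \<Rightarrow> real ^ 'm"
  assumes f: "linear f" and card: "CARD('m) = 2 * k + 1"
  shows "length bs + 1 = k \<and> jordan_nf (complex_matrix f)
      ((2, 0) # concat (map (\<lambda>b. [(1, \<i> * complex_of_real b), (1, - (\<i> * complex_of_real b))]) bs)
            @ [(1, 0)]) \<longleftrightarrow>
    length bs + 1 = k \<and>
    (\<exists>\<phi>. spectral_coords f k 0 (jordan_eigenvalues bs) (\<lambda>i. if i = 0 then 1 else 0) \<phi>)"
proof (intro conj_cong refl)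
  assume k: "length bs + 1 = k"
  define xs where "xs = concat (map (\<lambda>b. [\<i> * complex_of_real b, - (\<i> * complex_of_real b)]) bs) @ [0]"
  have xs: "concat (map (\<lambda>b. [(1, \<i> * complex_of_real b), (1, - (\<i> * complex_of_real b))]) bs) @ [(1, 0)]
    = map (Pair 1) xs"
    by (simp add: xs_def map_concat o_def)
  have len: "length xs + 2 = CARD('m)"
    using k card by (simp add: xs_def length_concat_pairs)
  have nth_xs: "xs ! (2 * i) = \<i> * of_real (bs ! i)" "xs ! (2 * i + 1) = - (\<i> * of_real (bs ! i))"
    if "i + 1 < k" for i
    using nth_concat_pairs[of i bs "\<lambda>b. \<i> * of_real b" "\<lambda>b. - (\<i> * of_real b)"] that k
    by (auto simp: xs_def nth_append length_concat_pairs)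
  have nth_xs_last: "xs ! (2 * k - 2) = 0"
    using k by (auto simp: xs_def nth_append length_concat_pairs)
  have Cons_nth: "(0 # 0 # xs) ! (2 * k) = 0" "(0 # 0 # xs) ! (2 * i + 2) = xs ! (2 * i)"
    "(0 # 0 # xs) ! (2 * i + 3) = xs ! (2 * i + 1)" for i
    using nth_xs_last k by (auto simp: numeral_3_eq_3)
  \<comment> \<open>Index layout on the Jordan side: 0 and 1 for the block, \<open>2 * i + 2\<close>
    and \<open>2 * i + 3\<close> for the imaginary pairs, \<open>2 * k\<close> for the final
    eigenvalue 0.\<close>
  have cases: "(\<forall>j<2 * k + 1. P j) \<longleftrightarrow>
      P 0 \<and> P 1 \<and> P (2 * k) \<and> (\<forall>i. i + 1 < k \<longrightarrow> P (2 * i + 2) \<and> P (2 * i + 3))" (is "?l \<longleftrightarrow> ?r") for P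
  proof
    assume r: ?r
    have "P (2 * i + 1) \<and> P (2 * i + 2)" if "i < k" for i
    proof
      show "P (2 * i + 1)"
      proof (cases i)
        case (Suc j)
        then have "2 * i + 1 = 2 * j + 3" "j + 1 < k" using that by auto
        then show ?thesis using r by metis
      qed (use r in simp)
      show "P (2 * i + 2)"
      proof (cases "i + 1 = k")
        case True
        then have "2 * i + 2 = 2 * k" by auto
        then show ?thesis using r by metis
      next
        case False
        then have "i + 1 < k" using that by auto
        then show ?thesis using r by metis
      qed
    qed
    then show ?l
      unfolding all_less_odd_iff using r by blast
  qed (use k in simp)
  show "jordan_nf (complex_matrix f)
      ((2, 0) # concat (map (\<lambda>b. [(1, \<i> * complex_of_real b), (1, - (\<i> * complex_of_real b))]) bs)
            @ [(1, 0)]) \<longleftrightarrow>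
    (\<exists>\<phi>. spectral_coords f k 0 (jordan_eigenvalues bs) (\<lambda>i. if i = 0 then 1 else 0) \<phi>)"
    unfolding xs
  proof
    assume "jordan_nf (complex_matrix f) ((2, 0) # map (Pair 1) xs)"
    then obtain \<phi> :: "nat \<Rightarrow> real ^ 'm \<Rightarrow> complex" where coords: "complex_coords \<phi>"
      and \<phi>: "\<And>j v. j < CARD('m) \<Longrightarrow> \<phi> j (f v) = (0 # 0 # xs) ! j * \<phi> j v + (if j = 0 then \<phi> 1 v else 0)"
      unfolding jordan_nf_iff_coords[OF f] by blast
    have lin: "linear (\<phi> j)" if "j < CARD('m)" for j
      using coords that by (simp add: complex_coords_def)
    have \<phi>_f: "\<phi> 0 (f v) = \<phi> 1 v" "\<phi> 1 (f v) = 0" "\<phi> (2 * k) (f v) = 0" for v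
      using \<phi>[of 0 v] \<phi>[of 1 v] \<phi>[of "2 * k" v] k card unfolding Cons_nth by auto
    have \<phi>_f': "\<phi> (2 * i + 2) (f v) = \<i> * of_real (bs ! i) * \<phi> (2 * i + 2) v"
      "\<phi> (2 * i + 3) (f v) = - (\<i> * of_real (bs ! i)) * \<phi> (2 * i + 3) v" if "i + 1 < k" for i v
      using \<phi>[of "2 * i + 2" v] \<phi>[of "2 * i + 3" v] that card unfolding Cons_nth nth_xs[OF that] by simp_all
    \<comment> \<open>The complex pair assembled from the top of the block of size two and the last coordinate.\<close>
    define \<phi>' where "\<phi>' j v = (if j = 0 then \<phi> 1 v else if j = 1 then \<phi> 0 v + \<i> * \<phi> (2 * k) v
      else if j = 2 then \<phi> 0 v - \<i> * \<phi> (2 * k) v else \<phi> (j - 1) v)" for j v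
    have \<phi>'_0: "\<phi>' 0 v = \<phi> 1 v" and \<phi>'_1: "\<phi>' 1 v = \<phi> 0 v + \<i> * \<phi> (2 * k) v"
      and \<phi>'_2: "\<phi>' 2 v = \<phi> 0 v - \<i> * \<phi> (2 * k) v"
      and \<phi>'_3: "\<phi>' (2 * i + 3) v = \<phi> (2 * i + 2) v"
      and \<phi>'_4: "\<phi>' (2 * i + 4) v = \<phi> (2 * i + 3) v" for i v
      by (simp_all add: \<phi>'_def numeral_3_eq_3)
    have "complex_coords \<phi>'"
      unfolding complex_coords_def
    proof (intro conjI allI impI)
      show "linear (\<phi>' j)" if "j < CARD('m)" for j
        using linear_add[OF lin] linear_scale[OF lin] that card k
        by (intro linearI) (auto simp: \<phi>'_def algebra_simps)
      fix u v assume uv: "\<forall>j<CARD('m). \<phi>' j u + \<i> * \<phi>' j v = 0"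
      have "\<forall>j<CARD('m). \<phi> j u + \<i> * \<phi> j v = 0"
      proof -
        have 0: "\<phi> 1 u + \<i> * \<phi> 1 v = 0"
          using uv[rule_format, of 0] by (simp add: \<phi>'_def)
        have 1: "(\<phi> 0 u + \<i> * \<phi> (2 * k) u) + \<i> * (\<phi> 0 v + \<i> * \<phi> (2 * k) v) = 0"
          using uv[rule_format, of 1] card k by (simp add: \<phi>'_def)
        have 2: "(\<phi> 0 u - \<i> * \<phi> (2 * k) u) + \<i> * (\<phi> 0 v - \<i> * \<phi> (2 * k) v) = 0"
          using uv[rule_format, of 2] card k by (simp add: \<phi>'_def)
        have 3: "\<phi> (2 * i + 2) u + \<i> * \<phi> (2 * i + 2) v = 0"
          "\<phi> (2 * i + 3) u + \<i> * \<phi> (2 * i + 3) v = 0" if "i + 1 < k" for i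
          using uv[rule_format, of "2 * i + 3"] uv[rule_format, of "2 * i + 4"] card that
          unfolding \<phi>'_3 \<phi>'_4 by simp_all
        have "\<phi> 0 u + \<i> * \<phi> 0 v = 0" "\<phi> (2 * k) u + \<i> * \<phi> (2 * k) v = 0"
          using complex_sum_diff_eq_0D[OF 1 2] by auto
        then show ?thesis
          unfolding card cases using 0 3 by blast
      qed
      then show "u = 0" "v = 0"
        using coords unfolding complex_coords_def by blast+
    qed
    moreover have "\<phi>' (2 * i + 1) (f v) = jordan_eigenvalues bs i * \<phi>' (2 * i + 1) v + (if i = 0 then 1 else 0) * \<phi>' 0 v"
      "\<phi>' (2 * i + 2) (f v) = cnj (jordan_eigenvalues bs i) * \<phi>' (2 * i + 2) v + cnj (if i = 0 then 1 else 0) * \<phi>' 0 v"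
      if "i < k" for i v
    proof -
      have "\<phi>' (2 * i + 1) (f v) = jordan_eigenvalues bs i * \<phi>' (2 * i + 1) v + (if i = 0 then 1 else 0) * \<phi>' 0 v \<and>
        \<phi>' (2 * i + 2) (f v) = cnj (jordan_eigenvalues bs i) * \<phi>' (2 * i + 2) v + cnj (if i = 0 then 1 else 0) * \<phi>' 0 v"
      proof (cases i)
        case 0
        have "2 * i + 1 = 1" "2 * i + 2 = 2"
          using 0 by auto
        then show ?thesis
          using 0 by (simp only: \<phi>'_0 \<phi>'_1 \<phi>'_2 \<phi>_f jordan_eigenvalues_def) simp
      next
        case (Suc j)
        then have "2 * i + 1 = 2 * j + 3" "2 * i + 2 = 2 * j + 4" "j + 1 < k"
          using that by auto
        then show ?thesis
          using Suc \<phi>_f'[of j v] by (simp only: \<phi>'_3 \<phi>'_4 jordan_eigenvalues_def) simp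
      qed
      then show "\<phi>' (2 * i + 1) (f v) = jordan_eigenvalues bs i * \<phi>' (2 * i + 1) v + (if i = 0 then 1 else 0) * \<phi>' 0 v"
        "\<phi>' (2 * i + 2) (f v) = cnj (jordan_eigenvalues bs i) * \<phi>' (2 * i + 2) v + cnj (if i = 0 then 1 else 0) * \<phi>' 0 v"
        by blast+
    qed
    moreover have "\<phi>' 0 (f v) = 0" for v
      unfolding \<phi>'_0 \<phi>_f ..
    ultimately show "\<exists>\<phi>. spectral_coords f k 0 (jordan_eigenvalues bs) (\<lambda>i. if i = 0 then 1 else 0) \<phi>"
      unfolding spectral_coords_def by (intro exI[of _ \<phi>']) simp
  next
    assume "\<exists>\<phi>. spectral_coords f k 0 (jordan_eigenvalues bs) (\<lambda>i. if i = 0 then 1 else 0) \<phi>"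
    then obtain \<phi>' where coords: "complex_coords \<phi>'" and \<phi>'_0: "\<And>v. \<phi>' 0 (f v) = 0"
      and \<phi>': "\<And>i v. i < k \<Longrightarrow> \<phi>' (2 * i + 1) (f v) = jordan_eigenvalues bs i * \<phi>' (2 * i + 1) v + (if i = 0 then 1 else 0) * \<phi>' 0 v"
      "\<And>i v. i < k \<Longrightarrow> \<phi>' (2 * i + 2) (f v) = cnj (jordan_eigenvalues bs i) * \<phi>' (2 * i + 2) v + cnj (if i = 0 then 1 else 0) * \<phi>' 0 v"
      unfolding spectral_coords_def by auto
    have lin: "linear (\<phi>' j)" if "j < CARD('m)" for j
      using coords that by (simp add: complex_coords_def)
    have \<phi>'_12: "\<phi>' 1 (f v) = \<phi>' 0 v" "\<phi>' 2 (f v) = \<phi>' 0 v" for v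
      using \<phi>'[of 0 v] k by (auto simp: jordan_eigenvalues_def numeral_2_eq_2)
    have \<phi>'_3: "\<phi>' (2 * i + 3) (f v) = \<i> * of_real (bs ! i) * \<phi>' (2 * i + 3) v"
      "\<phi>' (2 * i + 4) (f v) = - (\<i> * of_real (bs ! i)) * \<phi>' (2 * i + 4) v" if "i + 1 < k" for i v
    proof -
      have *: "2 * (i + 1) + 1 = 2 * i + 3" "2 * (i + 1) + 2 = 2 * i + 4" "i + 1 < k"
        using that by auto
      show "\<phi>' (2 * i + 3) (f v) = \<i> * of_real (bs ! i) * \<phi>' (2 * i + 3) v"
        "\<phi>' (2 * i + 4) (f v) = - (\<i> * of_real (bs ! i)) * \<phi>' (2 * i + 4) v"
        using \<phi>'[OF *(3), of v] unfolding *(1,2) by (auto simp: jordan_eigenvalues_def)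
    qed
    \<comment> \<open>The inverse substitution: half the sum of the first pair is the top of the
      chain, and its difference divided by \<open>2 * \<i>\<close> is the last coordinate.\<close>
    define \<phi> where "\<phi> j v = (if j = 0 then (\<phi>' 1 v + \<phi>' 2 v) / 2 else if j = 1 then \<phi>' 0 v
      else if j = 2 * k then (\<phi>' 1 v - \<phi>' 2 v) / (2 * \<i>) else \<phi>' (j + 1) v)" for j v
    have \<phi>_2: "\<phi> (2 * i + 2) v = \<phi>' (2 * i + 3) v" and \<phi>_3: "\<phi> (2 * i + 3) v = \<phi>' (2 * i + 4) v"
      if "i + 1 < k" for i v
    proof -
      have *: "2 * i + 2 \<noteq> 0" "2 * i + 2 \<noteq> 1" "2 * i + 3 \<noteq> 0" "2 * i + 3 \<noteq> 1"
        "2 * i + 2 \<noteq> 2 * k" "2 * i + 3 \<noteq> 2 * k" "2 * i + 2 + 1 = 2 * i + 3" "2 * i + 3 + 1 = 2 * i + 4"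
        using that by presburger+
      show "\<phi> (2 * i + 2) v = \<phi>' (2 * i + 3) v" "\<phi> (2 * i + 3) v = \<phi>' (2 * i + 4) v"
        by (simp_all only: \<phi>_def * if_False)
    qed
    have \<phi>_0: "\<phi> 0 v = (\<phi>' 1 v + \<phi>' 2 v) / 2" and \<phi>_2k: "\<phi> (2 * k) v = (\<phi>' 1 v - \<phi>' 2 v) / (2 * \<i>)" for v
      using k by (auto simp: \<phi>_def)
    have half: "x / 2 + \<i> * (y / 2) = 0 \<Longrightarrow> x + \<i> * y = 0"
      "x / (2 * \<i>) + \<i> * (y / (2 * \<i>)) = 0 \<Longrightarrow> x + \<i> * y = 0" for x y :: complex
    proof -
      have "x / (2 * \<i>) + \<i> * (y / (2 * \<i>)) = (x + \<i> * y) / (2 * \<i>)"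
        "x / 2 + \<i> * (y / 2) = (x + \<i> * y) / 2"
        by (simp_all only: add_divide_distrib times_divide_eq_right)
      then show "x / 2 + \<i> * (y / 2) = 0 \<Longrightarrow> x + \<i> * y = 0"
        "x / (2 * \<i>) + \<i> * (y / (2 * \<i>)) = 0 \<Longrightarrow> x + \<i> * y = 0"
        by auto
    qed
    have "complex_coords \<phi>"
      unfolding complex_coords_def
    proof (intro conjI allI impI)
      show "linear (\<phi> j)" if "j < CARD('m)" for j
        using linear_add[OF lin] linear_scale[OF lin] that card k
        by (intro linearI) (auto simp: \<phi>_def algebra_simps add_divide_distrib diff_divide_distrib
          scaleR_conv_of_real[where 'a=complex])
      fix u v assume uv: "\<forall>j<CARD('m). \<phi> j u + \<i> * \<phi> j v = 0"
      have "\<forall>j<CARD('m). \<phi>' j u + \<i> * \<phi>' j v = 0"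
      proof -
        have 0: "\<phi>' 0 u + \<i> * \<phi>' 0 v = 0"
          using uv[rule_format, of 1] card k by (simp add: \<phi>_def)
        have 1: "(\<phi>' 1 u + \<phi>' 2 u) + \<i> * (\<phi>' 1 v + \<phi>' 2 v) = 0"
          by (rule half(1)[OF uv[rule_format, of 0, unfolded \<phi>_0]]) (simp add: card)
        have 2: "(\<phi>' 1 u - \<phi>' 2 u) + \<i> * (\<phi>' 1 v - \<phi>' 2 v) = 0"
          by (rule half(2)[OF uv[rule_format, of "2 * k", unfolded \<phi>_2k]]) (simp add: card)
        have 3: "\<phi>' (2 * i + 3) u + \<i> * \<phi>' (2 * i + 3) v = 0"
          "\<phi>' (2 * i + 4) u + \<i> * \<phi>' (2 * i + 4) v = 0" if "i + 1 < k" for i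
          using uv[rule_format, of "2 * i + 2"] uv[rule_format, of "2 * i + 3"] card that
          unfolding \<phi>_2[OF that] \<phi>_3[OF that] by simp_all
        have pq: "p + q = 0 \<Longrightarrow> p - q = 0 \<Longrightarrow> p = 0 \<and> q = 0" for p q :: complex
          by (simp add: complex_eq_iff)
        have "\<phi>' 1 u + \<i> * \<phi>' 1 v + (\<phi>' 2 u + \<i> * \<phi>' 2 v) = 0"
          using 1 by (simp add: algebra_simps)
        moreover have "\<phi>' 1 u + \<i> * \<phi>' 1 v - (\<phi>' 2 u + \<i> * \<phi>' 2 v) = 0"
          using 2 by (simp add: algebra_simps)
        ultimately have 4: "\<phi>' 1 u + \<i> * \<phi>' 1 v = 0" "\<phi>' 2 u + \<i> * \<phi>' 2 v = 0"
          using pq by blast+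
        have "\<phi>' (2 * i + 1) u + \<i> * \<phi>' (2 * i + 1) v = 0 \<and> \<phi>' (2 * i + 2) u + \<i> * \<phi>' (2 * i + 2) v = 0" if "i < k" for i
        proof (cases i)
          case (Suc j)
          then have *: "2 * i + 1 = 2 * j + 3" "2 * i + 2 = 2 * j + 4" "j + 1 < k"
            using that by auto
          show ?thesis
            unfolding *(1,2) using 3[of j] *(3) by blast
        qed (use 4 in \<open>simp add: numeral_2_eq_2\<close>)
        then show ?thesis
          unfolding card all_less_odd_iff using 0 by blast
      qed
      then show "u = 0" "v = 0"
        using coords unfolding complex_coords_def by blast+
    qed
    moreover have "\<forall>j<CARD('m). \<forall>v. \<phi> j (f v) = (0 # 0 # xs) ! j * \<phi> j v + (if j = 0 then \<phi> 1 v else 0)"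
      unfolding card cases
    proof (intro conjI allI impI)
      fix v
      show "\<phi> 0 (f v) = (0 # 0 # xs) ! 0 * \<phi> 0 v + (if 0 = (0::nat) then \<phi> 1 v else 0)"
        using \<phi>'_12 by (simp add: \<phi>_def)
      show "\<phi> 1 (f v) = (0 # 0 # xs) ! 1 * \<phi> 1 v + (if 1 = (0::nat) then \<phi> 1 v else 0)"
        using \<phi>'_0 by (simp add: \<phi>_def)
      show "\<phi> (2 * k) (f v) = (0 # 0 # xs) ! (2 * k) * \<phi> (2 * k) v + (if 2 * k = 0 then \<phi> 1 v else 0)"
        using \<phi>'_12 k unfolding Cons_nth by (simp add: \<phi>_def)
      fix i assume i: "i + 1 < k"
      show "\<phi> (2 * i + 2) (f v) = (0 # 0 # xs) ! (2 * i + 2) * \<phi> (2 * i + 2) v + (if 2 * i + 2 = 0 then \<phi> 1 v else 0)"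
        using \<phi>'_3(1)[OF i, of v] unfolding Cons_nth nth_xs[OF i] \<phi>_2[OF i] by simp
      show "\<phi> (2 * i + 3) (f v) = (0 # 0 # xs) ! (2 * i + 3) * \<phi> (2 * i + 3) v + (if 2 * i + 3 = 0 then \<phi> 1 v else 0)"
        using \<phi>'_3(2)[OF i, of v] unfolding Cons_nth nth_xs[OF i] \<phi>_3[OF i] by simp
    qed
    ultimately show "jordan_nf (complex_matrix f) ((2, 0) # map (Pair 1) xs)"
      unfolding jordan_nf_iff_coords[OF f] using len by blast
  qed
qed

section \<open>Consequences of the SKT condition\<close>

locale complex_structure =
  fixes J :: "'a::euclidean_space \<Rightarrow> 'a"
  assumes linear_J: "linear J" and J_J: "J (J x) = - x"
begin

definition act :: "complex \<Rightarrow> 'a \<Rightarrow> 'a" where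
  "act c x = Re c *\<^sub>R x + Im c *\<^sub>R J x"

lemmas J_simps = linear_add[OF linear_J] linear_scale[OF linear_J] linear_diff[OF linear_J]
  linear_neg[OF linear_J] linear_0[OF linear_J] J_J

sublocale cv: vector_space act
  by unfold_locales (auto simp: act_def J_simps algebra_simps)

lemma act_of_real: "act (of_real r) x = r *\<^sub>R x"
  by (simp add: act_def)

lemma act_ii: "act \<i> x = J x"
  by (simp add: act_def)

lemma subspace_imp_real_subspace: "cv.subspace S \<Longrightarrow> subspace S"
  unfolding cv.subspace_def subspace_def by (metis act_of_real)

lemma span_subset_complex_span: "span S \<subseteq> cv.span S"
  by (intro span_minimal cv.span_superset subspace_imp_real_subspace cv.subspace_span)

lemma independent_imp_real_independent: "cv.independent S \<Longrightarrow> independent S"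
  unfolding cv.dependent_def dependent_def using span_subset_complex_span by blast

lemma finite_independent: "cv.independent S \<Longrightarrow> finite S"
  using independent_bound independent_imp_real_independent by blast

text \<open>The union of \<open>C\<close> and its image under \<open>J\<close> is a real basis: a
  real relation on it is a complex relation on \<open>C\<close> with coefficients
  \<open>Complex (u x) (u (J x))\<close>.\<close>

lemma card_complex_basis:
  assumes C: "cv.independent C" "cv.span C = UNIV"
  shows "2 * card C = DIM('a)"
proof -
  have fin: "finite C"
    by (rule finite_independent) fact
  have inj: "inj_on J C"
    by (metis J_J inj_onI neg_equal_iff_equal)
  have disj: "C \<inter> J ` C = {}"
  proof (rule ccontr)
    assume "C \<inter> J ` C \<noteq> {}"
    then obtain b where b: "b \<in> C" "J b \<in> C" by auto
    have "J b \<noteq> b"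
      using J_J[of b] C(1) b cv.dependent_zero[of C] by (metis eq_neg_iff_add_eq_0 scaleR_2 scaleR_eq_0_iff zero_neq_numeral)
    then have "J b \<in> cv.span (C - {J b})"
      using b cv.span_scale[OF cv.span_base[of b "C - {J b}"], of \<i>] by (simp add: act_ii)
    then show False
      using C(1) b cv.dependent_def by blast
  qed
  have "independent (C \<union> J ` C)"
  proof (rule independent_if_scalars_zero)
    fix u x assume sum: "(\<Sum>x\<in>C \<union> J ` C. u x *\<^sub>R x) = 0" and x: "x \<in> C \<union> J ` C"
    have "(\<Sum>x\<in>C. act (Complex (u x) (u (J x))) x) = 0"
      using sum fin disj by (simp add: sum.union_disjoint sum.reindex[OF inj] act_def sum.distrib)
    then have "Complex (u c) (u (J c)) = 0" if "c \<in> C" for c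
      using cv.independentD[OF C(1) fin subset_refl, of "\<lambda>x. Complex (u x) (u (J x))" c] that by blast
    then show "u x = 0"
      using x by (auto simp: complex_eq_iff)
  qed (use fin in simp)
  moreover have "UNIV \<subseteq> span (C \<union> J ` C)"
  proof
    fix x
    have "cv.subspace (span (C \<union> J ` C))"
    proof -
      have "J y \<in> span (C \<union> J ` C)" if "y \<in> span (C \<union> J ` C)" for y
      proof -
        have "J y \<in> span (J ` (C \<union> J ` C))"
          using that by (simp add: linear_span_image[OF linear_J])
        moreover have "J ` (C \<union> J ` C) \<subseteq> span (C \<union> J ` C)"
          by (auto simp: J_J intro: span_base span_neg[OF span_base])
        ultimately show ?thesis
          using span_minimal[OF _ subspace_span] by blast
      qed
      then show ?thesis
        unfolding cv.subspace_def by (auto simp: act_def intro!: span_add span_scale span_zero)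
    qed
    then have "cv.span C \<subseteq> span (C \<union> J ` C)"
      by (intro cv.span_minimal) (auto intro: span_base)
    then show "x \<in> span (C \<union> J ` C)"
      using C(2) by auto
  qed
  ultimately have "card (C \<union> J ` C) = DIM('a)"
    using basis_card_eq_dim[of "C \<union> J ` C" UNIV] by simp
  then show ?thesis
    using fin disj by (simp add: card_Un_disjoint card_image[OF inj])
qed

end

text \<open>If the vectors are distinct, there are too many of them to be independent. A repetition
  is invisible to the set of values and gives the relation \<open>y i - y j = 0\<close>
  instead.\<close>

lemma ex_linear_relation:
  fixes y :: "nat \<Rightarrow> 'a::euclidean_space"
  shows "\<exists>c. (\<Sum>i\<le>DIM('a). c i *\<^sub>R y i) = 0 \<and> (\<exists>i\<le>DIM('a). c i \<noteq> 0)"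
proof (cases "inj_on y {..DIM('a)}")
  case True
  then have "card (y ` {..DIM('a)}) = DIM('a) + 1"
    by (simp add: card_image)
  then have "dependent (y ` {..DIM('a)})"
    using independent_bound[of "y ` {..DIM('a)}"] by auto
  then obtain u v where "v \<in> y ` {..DIM('a)}" "u v \<noteq> 0" "(\<Sum>v\<in>y ` {..DIM('a)}. u v *\<^sub>R v) = 0"
    by (auto simp: dependent_finite)
  then show ?thesis
    by (intro exI[of _ "u \<circ> y"]) (auto simp: sum.reindex[OF True])
next
  case False
  then obtain i j where ij: "i \<le> DIM('a)" "j \<le> DIM('a)" "i \<noteq> j" "y i = y j"
    by (auto simp: inj_on_def)
  define c :: "nat \<Rightarrow> real" where "c l = (if l = i then 1 else 0) + (if l = j then -1 else 0)" for l
  have "(\<Sum>l\<le>DIM('a). c l *\<^sub>R y l) =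
      (\<Sum>l\<le>DIM('a). (if l = i then y l else 0) + (if l = j then - y l else 0))"
    by (intro sum.cong) (auto simp: c_def)
  also have "\<dots> = 0"
    using ij by (simp add: sum.distrib)
  finally show ?thesis
    using ij by (intro exI[of _ c]) (auto simp: c_def intro!: exI[of _ i])
qed

section \<open>The unit of normal, \<open>J\<close>-image and complement attached to an SKT
  structure\<close>

locale skt_almost_abelian =
  fixes f :: "real ^ 'm \<Rightarrow> real ^ 'm" and g and J
  assumes linear_f: "linear f" and skt: "skt_structure (almost_abelian_bracket f) g J"
begin

lemma skt_structureD:
  shows g: "bilinear g" "g X Y = g Y X" "X \<noteq> 0 \<Longrightarrow> g X X > 0"
    and J: "linear J" "J (J X) = - X" "g (J X) (J Y) = g X Y"
    and integrable: "almost_abelian_bracket f (J X) (J Y) - J (almost_abelian_bracket f (J X) Y)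
     - J (almost_abelian_bracket f X (J Y)) - almost_abelian_bracket f X Y = 0"
    and pluriclosed: "ce_diff (almost_abelian_bracket f) (form_pullback J
      (ce_diff (almost_abelian_bracket f) (fundamental_form g J))) [X, Y, Z, W] = 0"
  using skt unfolding skt_structure_iff inner_product_def by blast+

sublocale complex_structure J
  by (rule complex_structure.intro) (rule J)+

lemmas g_simps = bilinear_ladd[OF g(1)] bilinear_radd[OF g(1)] bilinear_lsub[OF g(1)] bilinear_rsub[OF g(1)]
  bilinear_lmul[OF g(1)] bilinear_rmul[OF g(1)] bilinear_lneg[OF g(1)] bilinear_rneg[OF g(1)]
  bilinear_lzero[OF g(1)] bilinear_rzero[OF g(1)]

lemma g_J_left: "g (J X) Y = - g X (J Y)"
  using J(3)[of X "J Y"] by (simp add: J(2) g_simps)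

text \<open>The adjoint map of \<open>(0, 1)\<close>, that is, of \<open>e\<close>.\<close>

definition F where "F X = (f (fst X), 0 :: real)"

lemma linear_F: "linear F"
  using linear_f by (auto intro!: linearI simp: F_def linear_add linear_scale)

lemmas F_simps = linear_add[OF linear_F] linear_scale[OF linear_F] linear_diff[OF linear_F]
  linear_neg[OF linear_F] linear_0[OF linear_F]

lemma snd_F [simp]: "snd (F X) = 0"
  by (simp add: F_def)

lemma bracket_eq: "almost_abelian_bracket f X Y = snd X *\<^sub>R F Y - snd Y *\<^sub>R F X"
  by (simp add: almost_abelian_bracket_def F_def)

text \<open>Riesz representation of \<open>snd\<close> with respect to \<open>g\<close>: the
  operator \<open>T\<close> expressing \<open>g\<close> through the standard inner product is
  injective by definiteness, hence onto.\<close>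

lemma ex_normal: "\<exists>N. \<forall>Y. g N Y = snd Y"
proof -
  define T where "T X = (\<Sum>b\<in>Basis. g X b *\<^sub>R b)" for X
  have T: "inner (T X) Y = g X Y" for X Y
  proof -
    have "g X Y = g X (\<Sum>b\<in>Basis. inner Y b *\<^sub>R b)"
      by (simp only: euclidean_representation)
    also have "\<dots> = (\<Sum>b\<in>Basis. inner Y b * g X b)"
    proof -
      have "linear (g X)"
        using g(1) unfolding bilinear_def by blast
      then show ?thesis
        by (simp add: linear_sum linear_scale)
    qed
    finally show ?thesis
      unfolding T_def inner_sum_left inner_scaleR_left by (simp add: inner_commute mult.commute)
  qed
  have lin: "linear T"
    by (rule linearI) (simp_all add: T_def g_simps scaleR_add_left sum.distrib scaleR_sum_right)
  have "inj T"
  proof (subst linear_injective_0[OF lin], intro allI impI)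
    fix X assume "T X = 0"
    then have "g X X = 0"
      using T[of X X] by simp
    then show "X = 0"
      using g(3)[of X] by fastforce
  qed
  then have "surj T"
    using lin by (intro linear_injective_imp_surjective) simp_all
  then obtain N where "T N = (0, 1)"
    by (metis surjD)
  then have "g N Y = snd Y" for Y
    using T[of N Y] by (simp add: inner_prod_def)
  then show ?thesis by blast
qed

definition N where "N = (SOME N. \<forall>Y. g N Y = snd Y)"

lemma g_N: "g N Y = snd Y"
  using someI_ex[OF ex_normal] unfolding N_def by blast

definition E where "E = J N"

text \<open>By \<open>g_N\<close> this is \<open>g N N\<close>; the normal is not scaled to length
  one.\<close>

definition s where "s = snd N"

text \<open>The component of \<open>F E\<close> along \<open>E\<close>, since
  \<open>g E E = s\<close>.\<close>

definition a where "a = g E (F E) / s"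

lemma snd_J: "snd (J X) = - g E X"
  unfolding E_def g_J_left by (simp add: g_N)

lemma s_pos: "s > 0"
proof -
  have "N \<noteq> 0"
    using g_N[of "(0, 1)"] by (auto simp: g_simps)
  then show ?thesis
    using g(3)[of N] by (simp add: g_N s_def)
qed

lemma g_E_E: "g E E = s"
  unfolding E_def J(3) by (simp add: g_N s_def)

lemma J_E: "J E = - N"
  by (simp add: E_def J)

lemma snd_E: "snd E = 0"
  using g_N[of E] g(2)[of N E] g_J_left[of N N] unfolding E_def by linarith

text \<open>By \<open>g_N\<close> and \<open>snd_J\<close> this is the orthogonal complement of
  \<open>N\<close> and \<open>E\<close>; in this form its invariance under \<open>J\<close> is
  immediate.\<close>

definition V where "V = {X. snd X = 0 \<and> snd (J X) = 0}"

lemma subspace_V: "cv.subspace V"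
  unfolding cv.subspace_def V_def by (auto simp: act_def J_simps)

lemmas V_intros = cv.subspace_add[OF subspace_V] cv.subspace_diff[OF subspace_V]
  cv.subspace_scale[OF subspace_V] cv.subspace_0[OF subspace_V] cv.subspace_neg[OF subspace_V]

lemma J_V: "X \<in> V \<Longrightarrow> J X \<in> V"
  using V_intros(3)[of X \<i>] by (simp add: act_ii)

text \<open>Integrability at \<open>N\<close> and \<open>X\<close>: since \<open>E\<close>,
  \<open>X\<close> and \<open>J X\<close> lie in the Abelian ideal, only the brackets of
  \<open>N\<close> with \<open>X\<close> and with \<open>J X\<close> survive.\<close>

lemma F_J:
  assumes "X \<in> V"
  shows "F (J X) = J (F X)"
proof -
  have X: "snd X = 0" "snd (J X) = 0"
    using assms by (auto simp: V_def)
  have "- J (s *\<^sub>R F (J X)) - s *\<^sub>R F X = 0"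
    using integrable[of N X] X snd_E unfolding bracket_eq E_def[symmetric] by (simp add: s_def J_simps)
  moreover have "s *\<^sub>R (J (F (J X)) + F X) = - (- J (s *\<^sub>R F (J X)) - s *\<^sub>R F X)"
    by (simp add: J_simps algebra_simps)
  ultimately have "s *\<^sub>R (J (F (J X)) + F X) = 0"
    by simp
  then have "J (F (J X)) = - F X"
    using s_pos by (simp add: eq_neg_iff_add_eq_0)
  then have "J (J (F (J X))) = J (- F X)"
    by simp
  then show ?thesis
    by (simp add: J_simps)
qed

text \<open>The image of \<open>F\<close> lies in the ideal, and so does \<open>J (F X)\<close>,
  being \<open>F (J X)\<close>.\<close>

lemma F_V: "X \<in> V \<Longrightarrow> F X \<in> V"
  using F_J[of X] by (simp add: V_def flip: F_J)

lemma F_act: "X \<in> V \<Longrightarrow> F (act c X) = act c (F X)"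
  by (simp add: act_def F_simps F_J)

lemma F_E: "F E - a *\<^sub>R E \<in> V"
  using s_pos by (simp add: V_def snd_E J_simps snd_J g_simps g_E_E a_def)

text \<open>Half the value of \<open>L(L + a) g\<close> at \<open>(X, X)\<close>, with
  \<open>L\<close> the operator of the introduction; the arguments \<open>N\<close>,
  \<open>E\<close>, \<open>X\<close>, \<open>J X\<close> isolate it in the 4-form.\<close>

lemma pluriclosed_V:
  assumes X: "X \<in> V"
  shows "a * g (F X) X + g (F (F X)) X + g (F X) (F X) = 0"
proof -
  define \<beta> where "\<beta> = form_pullback J (ce_diff (almost_abelian_bracket f) (fundamental_form g J))"
  have \<beta>: "\<beta> [U, X, Y] =
      snd (J U) * (g (J (F (J Y))) (J X) - g (J (F (J X))) (J Y))
    + snd (J X) * (g (J (F (J U))) (J Y) - g (J (F (J Y))) (J U))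
    + snd (J Y) * (g (J (F (J X))) (J U) - g (J (F (J U))) (J X))" for U X Y
    unfolding \<beta>_def form_pullback_def ce_diff_3 fundamental_form_def bracket_eq list.map
    by (simp add: J_simps g_simps g_J_left algebra_simps)
  have V: "X \<in> V" "J X \<in> V" "F X \<in> V" "F (J X) \<in> V"
    using X F_V J_V by auto
  have snd_V: "snd Y = 0" "snd (J Y) = 0" if "Y \<in> V" for Y
    using that by (auto simp: V_def)
  have snd_JF: "snd (J (F E)) = - (a * s)"
    using s_pos by (simp add: snd_J a_def)
  \<comment> \<open>The value of \<open>d(J\<^sup>*d\<sigma>)\<close> on \<open>(N, E, X, J X)\<close>.\<close>
  have "- (s * (a * s) * (2 * g (F X) X)) - s * (s * g (F (F X)) X + s * g (F X) (F X)) +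
     s * (- (s * g (F (F X)) X) - s * g (F X) (F X)) = 0"
    using pluriclosed[of N E X "J X"]
    unfolding \<beta>_def[symmetric] ce_diff_4 bracket_eq \<beta>
    by (simp add: snd_V[OF V(1)] snd_V[OF V(2)] snd_V[OF V(3)] snd_V[OF V(4)] snd_E J_simps
        F_simps g_simps F_J V snd_JF J_E s_def[symmetric] g_J_left)
  moreover have "(2 * s * s) * (a * g (F X) X + g (F (F X)) X + g (F X) (F X)) =
     - (- (s * (a * s) * (2 * g (F X) X)) - s * (s * g (F (F X)) X + s * g (F X) (F X)) +
     s * (- (s * g (F (F X)) X) - s * g (F X) (F X)))"
    by (simp add: algebra_simps)
  ultimately have "(2 * s * s) * (a * g (F X) X + g (F (F X)) X + g (F X) (F X)) = 0"
    by simp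
  then show ?thesis
    using s_pos by simp
qed

text \<open>Because \<open>g X (J X) = 0\<close>, the operator \<open>L\<close> multiplies
  \<open>g X X\<close> by \<open>2 * Re z\<close> on an eigenvector, so \<open>2 * Re z\<close> is a
  root of \<open>t * (t + a)\<close>.\<close>

lemma eigenvalue_V:
  assumes X: "X \<in> V" "X \<noteq> 0" and eig: "F X = act z X"
  shows "Re z \<in> {0, - a / 2}"
proof -
  have JX: "g X (J X) = 0"
    using g_J_left[of X X] g(2)[of X "J X"] by linarith
  have "Re z * (2 * Re z + a) * g X X = a * g (F X) X + g (F (F X)) X + g (F X) (F X)"
    using X(1) JX by (simp add: eig F_J F_simps act_def J_simps g_simps g_J_left algebra_simps)
  then have "Re z * (2 * Re z + a) * g X X = 0"
    using pluriclosed_V[OF X(1)] by simp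
  then show ?thesis
    using g(3)[OF X(2)] by auto
qed

text \<open>As the eigenvalue condition removes the quadratic term,
  \<open>(4 * Re z + a) * g X Y + g Y Y = 0\<close> holds for every start \<open>X\<close> of the
  chain. Comparing the starts \<open>X\<close> and \<open>X + Y\<close> gives
  \<open>4 * Re z + a = 0\<close> if \<open>Y\<close> is nonzero, and then
  \<open>g Y Y = 0\<close>.\<close>

lemma no_jordan_chain_V:
  assumes XY: "X \<in> V" "Y \<in> V" and FX: "F X = act z X + Y" and FY: "F Y = act z Y"
  shows "Y = 0"
proof (rule ccontr)
  assume "Y \<noteq> 0"
  then have pos: "g Y Y > 0" and z: "Re z \<in> {0, - a / 2}"
    using g(3) eigenvalue_V[OF XY(2) _ FY] by auto
  have J0: "g W (J W) = 0" for W
    using g_J_left[of W W] g(2)[of W "J W"] by linarith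
  \<comment> \<open>Applied to \<open>X\<close> and to \<open>X + Y\<close>, which start chains with the same second vector.\<close>
  have quad: "Re z * (2 * Re z + a) * g X' X' + (4 * Re z + a) * g X' Y + g Y Y = 0"
    if X': "X' \<in> V" "F X' = act z X' + Y" for X'
  proof -
    have YJ: "g Y (J X') = - g X' (J Y)"
      using g_J_left[of X' Y] g(2)[of Y "J X'"] by linarith
    have "Re z * (2 * Re z + a) * g X' X' + (4 * Re z + a) * g X' Y + g Y Y
        = a * g (F X') X' + g (F (F X')) X' + g (F X') (F X')"
      using X' XY(2) J0
      by (simp add: X'(2) FY F_simps F_J act_def J_simps g_simps g_J_left YJ g(2)[of Y X'] algebra_simps)
    then show ?thesis
      using pluriclosed_V[OF X'(1)] by simp
  qed
  have z0: "Re z * (2 * Re z + a) = 0"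
    using z by auto
  have "F (X + Y) = act z (X + Y) + Y"
    by (simp add: F_simps FX FY cv.scale_right_distrib)
  then have "(4 * Re z + a) * g X Y + g Y Y = 0" "(4 * Re z + a) * (g X Y + g Y Y) + g Y Y = 0"
    using quad[OF XY(1) FX] quad[of "X + Y"] XY V_intros(1) unfolding z0 by (auto simp: g_simps)
  then have "(4 * Re z + a) * g Y Y = 0" "(4 * Re z + a) * g X Y + g Y Y = 0"
    by (simp_all add: algebra_simps)
  then show False
    using pos by auto
qed

section \<open>Complex diagonalizability of \<open>F\<close> on \<open>V\<close>\<close>

definition S where "S = {X \<in> V. \<exists>z. F X = act z X}"

lemma span_S_subset: "cv.span S \<subseteq> V"
  by (rule cv.span_minimal[OF _ subspace_V]) (auto simp: S_def)

text \<open>On an eigenvector with eigenvalue \<open>z'\<close> other than \<open>z\<close>, the map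
  \<open>F - z\<close> is multiplication by \<open>z' - z\<close> and can be inverted; the
  eigenvectors with eigenvalue \<open>z\<close> are collected in \<open>X\<close>.\<close>

lemma span_S_decompose:
  assumes "U \<in> cv.span S"
  shows "\<exists>W\<in>cv.span S. \<exists>X\<in>V. F X = act z X \<and> U = F W - act z W + X"
  using assms
proof (induction rule: cv.span_induct_alt)
  case base
  show ?case
    by (intro bexI[of _ 0]) (auto simp: F_simps V_intros cv.span_zero)
next
  case (step c x y)
  then obtain W X where WX: "W \<in> cv.span S" "X \<in> V" "F X = act z X" "y = F W - act z W + X"
    by blast
  obtain z' where x: "x \<in> V" "F x = act z' x"
    using step(1) by (auto simp: S_def)
  show ?case
  proof (cases "z' = z")
    case True
    have "F (act c x + X) = act z (act c x + X)"
      using x True by (simp add: F_simps F_act WX(3) cv.scale_right_distrib mult.commute)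
    then show ?thesis
      using WX x by (intro bexI[of _ W] bexI[of _ "act c x + X"]) (auto simp: V_intros)
  next
    case False
    define x' where "x' = act (c / (z' - z)) x"
    have "F x' - act z x' = act (c / (z' - z) * z' - z * (c / (z' - z))) x"
      using x by (simp only: x'_def F_act cv.scale_scale cv.scale_left_diff_distrib)
    moreover have "c / (z' - z) * z' - z * (c / (z' - z)) = c"
      using False by (simp add: divide_simps) (simp add: algebra_simps)
    ultimately have "act c x = F x' - act z x'"
      by simp
    moreover have "x' \<in> cv.span S"
      unfolding x'_def using step(1) by (intro cv.span_scale cv.span_base)
    ultimately show ?thesis
      using WX by (intro bexI[of _ "x' + W"] bexI[of _ X])
        (auto simp: F_simps cv.scale_right_distrib cv.span_add)
  qed
qed

text \<open>
  Any \<open>X\<close> as below differs by an element of the span from the start of a Jordan chain of length at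
  most two, which has to be an eigenvector.
\<close>

lemma span_S_closed:
  assumes X: "X \<in> V" "F X - act z X \<in> cv.span S"
  shows "X \<in> cv.span S"
proof -
  obtain W e where W: "W \<in> cv.span S" and e: "e \<in> V" "F e = act z e" "F X - act z X = F W - act z W + e"
    using span_S_decompose[OF X(2)] by blast
  have V: "X - W \<in> V"
    using W span_S_subset X(1) by (auto intro: V_intros)
  have "F (X - W) = act z (X - W) + e"
    using e(3) by (simp add: F_simps cv.scale_right_diff_distrib algebra_simps)
  then have "e = 0"
    using no_jordan_chain_V[OF V e(1) _ e(2)] by blast
  then have "X - W \<in> S"
    using V \<open>F (X - W) = _\<close> by (auto simp: S_def)
  then have "X - W + W \<in> cv.span S"
    using W by (blast intro: cv.span_add cv.span_base)
  then show ?thesis by simp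
qed

text \<open>\<open>poly_act p Y\<close> is \<open>p(F) Y\<close>, where \<open>\<i>\<close> acts as \<open>J\<close>.\<close>

definition poly_act :: "complex poly \<Rightarrow> (real ^ 'm) \<times> real \<Rightarrow> (real ^ 'm) \<times> real" where
  "poly_act p Y = fold_coeffs (\<lambda>c X. act c Y + F X) p 0"

lemma poly_act_0 [simp]: "poly_act 0 Y = 0"
  by (simp add: poly_act_def)

lemma poly_act_pCons: "poly_act (pCons c p) Y = act c Y + F (poly_act p Y)"
  by (cases "c = 0 \<and> p = 0") (auto simp: poly_act_def F_simps)

lemma poly_act_V: "Y \<in> V \<Longrightarrow> poly_act p Y \<in> V"
  by (induction p) (auto simp: poly_act_pCons intro: V_intros F_V)

lemma poly_act_add: "poly_act (p + q) Y = poly_act p Y + poly_act q Y"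
proof (induction p q rule: poly_induct2)
  case (pCons a p b q)
  then show ?case
    by (simp add: poly_act_pCons F_simps cv.scale_left_distrib)
qed simp

lemma poly_act_smult: "Y \<in> V \<Longrightarrow> poly_act (Polynomial.smult c p) Y = act c (poly_act p Y)"
  by (induction p) (simp_all add: poly_act_pCons F_act poly_act_V cv.scale_right_distrib)

lemma poly_act_linear_factor:
  assumes "Y \<in> V"
  shows "poly_act ([:- z, 1:] * p) Y = F (poly_act p Y) - act z (poly_act p Y)"
proof -
  have "[:- z, 1:] * p = Polynomial.smult (- z) p + pCons 0 p"
    by simp
  then show ?thesis
    using assms by (simp only: poly_act_add poly_act_smult poly_act_pCons) simp
qed

text \<open>Over the complex numbers \<open>p\<close> splits into linear factors, and
  \<open>span_S_closed\<close> cancels them one at a time until a nonzero constant is left.\<close>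

lemma poly_act_imp_span_S:
  assumes "p \<noteq> 0" "Y \<in> V" "poly_act p Y \<in> cv.span S"
  shows "Y \<in> cv.span S"
  using assms
proof (induction "degree p" arbitrary: p)
  case 0
  then obtain c where c: "p = [:c:]" "c \<noteq> 0"
    by (metis degree_eq_zeroE pCons_0_0)
  then have "act c Y \<in> cv.span S"
    using 0 by (simp add: poly_act_pCons F_simps)
  then show ?case
    using cv.span_scale[of "act c Y" S "inverse c"] c(2) by simp
next
  case (Suc d)
  then obtain z where "poly p z = 0"
    using fundamental_theorem_of_algebra[of p] by (metis constant_degree nat.distinct(1))
  then obtain q where q: "p = [:- z, 1:] * q"
    by (metis dvdE poly_eq_0_iff_dvd)
  then have "q \<noteq> 0"
    using Suc(3) by auto
  then have "degree p = degree q + 1"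
    unfolding q by (subst degree_mult_eq) auto
  moreover have "poly_act q Y \<in> cv.span S"
    using Suc(4,5) poly_act_linear_factor[of Y z q] span_S_closed[of "poly_act q Y" z] poly_act_V[of Y q]
    unfolding q by simp
  ultimately show ?case
    using Suc \<open>q \<noteq> 0\<close> by simp
qed

text \<open>The iterates of \<open>F\<close> on \<open>Y\<close> up to the dimension are linearly
  dependent, so some nonzero polynomial in \<open>F\<close> annihilates \<open>Y\<close>, and
  \<open>0\<close> lies in the span.\<close>

lemma span_S: "cv.span S = V"
proof
  show "V \<subseteq> cv.span S"
  proof
    fix Y assume Y: "Y \<in> V"
    define D where "D = DIM((real ^ 'm) \<times> real)"
    define y where "y i = (F ^^ i) Y" for i
    have monom: "poly_act (Polynomial.monom (of_real c) i) Y = c *\<^sub>R y i" for c i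
      by (induction i) (simp_all add: monom_0 monom_Suc poly_act_pCons F_simps y_def act_of_real)
    obtain c i where c: "(\<Sum>i\<le>D. c i *\<^sub>R y i) = 0" "i \<le> D" "c i \<noteq> 0"
      using ex_linear_relation[of y] unfolding D_def by blast
    define p where "p = (\<Sum>i\<le>D. Polynomial.monom (complex_of_real (c i)) i)"
    have "poly_act (\<Sum>i\<in>A. Polynomial.monom (complex_of_real (c i)) i) Y = (\<Sum>i\<in>A. c i *\<^sub>R y i)"
      if "finite A" for A
      using that by (induction A) (simp_all add: poly_act_add monom)
    then have "poly_act p Y = 0"
      unfolding p_def using c(1) by simp
    moreover have "poly.coeff p i = of_real (c i)"
      using c(2) by (simp add: p_def coeff_sum)
    then have "p \<noteq> 0"
      using c(3) by auto
    ultimately show "Y \<in> cv.span S"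
      using poly_act_imp_span_S[OF _ Y] cv.span_zero by metis
  qed
qed (rule span_S_subset)

section \<open>Coordinates from a basis of eigenvectors\<close>

text \<open>Correcting \<open>E\<close> by an element of \<open>V\<close> gives \<open>E'\<close>
  with \<open>F E' = a E' + e\<close>, where \<open>e\<close> is 0 or an eigenvector with eigenvalue
  \<open>a\<close>. Together with a complex eigenbasis \<open>B\<close> of \<open>V\<close> it is a
  complex basis of the whole algebra; its coordinate functionals, restricted to the ideal, are
  \<open>c\<close> and the \<open>\<zeta> i\<close>.\<close>

lemma ex_normal_form:
  assumes card: "CARD('m) = 2 * k + 1"
  shows "\<exists>b z w c \<zeta>. normal_form f k b z w c \<zeta> \<and> (\<forall>i<k. Re (z i) \<in> {0, - b / 2}) \<and>
    ((\<forall>i<k. w i = 0) \<or> k > 0 \<and> b = 0 \<and> z 0 = 0 \<and> (\<forall>i<k. w i = (if i = 0 then 1 else 0)))"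
proof -
  obtain W e where W: "W \<in> cv.span S" and e: "e \<in> V" "F e = act (of_real a) e"
    and We: "F E - a *\<^sub>R E = F W - act (of_real a) W + e"
    using span_S_decompose[of "F E - a *\<^sub>R E" "of_real a"] F_E span_S by auto
  have WV: "W \<in> V"
    using W span_S by simp
  define E' where "E' = E - W"
  have F_E': "F E' = a *\<^sub>R E' + e"
    using We by (simp add: E'_def F_simps act_of_real algebra_simps)
  have E'_V: "snd E' = 0" "snd (J E') = - s"
    using WV by (auto simp: E'_def V_def snd_E J_simps J_E s_def)
  \<comment> \<open>If \<open>e\<close> is nonzero, its real eigenvalue \<open>a\<close> must lie in
    \<open>{0, - a / 2}\<close>.\<close>
  have e_eig: "e = 0 \<or> a = 0"
    using eigenvalue_V[OF e(1) _ e(2)] by (cases "e = 0") auto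
  \<comment> \<open>Extending from \<open>e\<close> makes the off-diagonal part of
    \<open>F E'\<close> a single basis vector.\<close>
  define B0 where "B0 = (if e = 0 then {} else {e})"
  have B0: "B0 \<subseteq> S" "cv.independent B0"
    using e by (auto simp: B0_def S_def cv.independent_empty cv.dependent_single)
  obtain B where B: "B0 \<subseteq> B" "B \<subseteq> S" "cv.independent B" "S \<subseteq> cv.span B"
    using cv.maximal_independent_subset_extend[OF B0] by blast
  have span_B: "cv.span B = V"
    using span_S B cv.span_mono[of B S] cv.span_minimal[OF B(4) cv.subspace_span] by auto
  have finB: "finite B"
    by (rule finite_independent) fact
  define C where "C = insert E' B"
  have E'_B: "E' \<notin> cv.span B" "E' \<notin> B"
    using E'_V s_pos span_B cv.span_base[of E' B] by (auto simp: V_def)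
  have indep_C: "cv.independent C"
    unfolding C_def by (rule cv.independent_insertI) fact+
  have span_C: "cv.span C = UNIV"
  proof -
    have "X \<in> cv.span C" for X
    proof -
      \<comment> \<open>Solves for \<open>X - act \<gamma> E'\<close> to lie in \<open>V\<close>,
        using \<open>snd E' = 0\<close> and \<open>snd (J E') = - s\<close>.\<close>
      define \<gamma> where "\<gamma> = Complex (- snd (J X) / s) (- snd X / s)"
      have "snd (act \<gamma> E') = snd X" "snd (J (act \<gamma> E')) = snd (J X)"
        using s_pos by (auto simp: act_def J_simps E'_V \<gamma>_def)
      then have "X - act \<gamma> E' \<in> cv.span B"
        unfolding span_B by (simp add: V_def J_simps)
      then have "X - act \<gamma> E' \<in> cv.span C"
        unfolding C_def using cv.span_mono[OF subset_insertI] by blast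
      moreover have "act \<gamma> E' \<in> cv.span C"
        unfolding C_def by (intro cv.span_scale cv.span_base) simp
      ultimately have "X - act \<gamma> E' + act \<gamma> E' \<in> cv.span C"
        by (rule cv.span_add)
      then show ?thesis by simp
    qed
    then show ?thesis by auto
  qed
  have finC: "finite C"
    using finB by (simp add: C_def)
  have "card B = k"
    using card_complex_basis[OF indep_C span_C] finB E'_B card by (simp add: C_def)
  define R where "R = cv.representation C"
  have R: "X = act (R X E') E' + (\<Sum>b\<in>B. act (R X b) b)" for X
    using cv.sum_representation_eq[OF indep_C _ finC subset_refl, of X] span_C finB E'_B
    unfolding R_def by (simp add: C_def)
  have R_add: "R (X + Y) b = R X b + R Y b" and R_act: "R (act r X) b = r * R X b" for X Y b r
    using cv.representation_add[OF indep_C, of Y X] cv.representation_scale[OF indep_C, of X r] span_C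
    by (auto simp: R_def)
  have R_sum: "R (\<Sum>i\<in>A. h i) b = (\<Sum>i\<in>A. R (h i) b)" if "finite A"
    for A :: "((real ^ 'm) \<times> real) set" and h b
    using that cv.representation_zero[of C] by (induction A) (simp_all add: R_add, simp add: R_def)
  have R_C: "R x b = (if b = x then 1 else 0)" if "x \<in> C" for x b
    using cv.representation_basis[OF indep_C that] by (simp add: R_def)
  \<comment> \<open>On the ideal the coordinate at \<open>E'\<close> is real, because
    \<open>snd\<close> detects exactly its imaginary part; this is what provides the real functional
    \<open>c\<close>.\<close>
  have R_E': "Im (R X E') = 0" if "snd X = 0" for X
  proof -
    have "(\<Sum>b\<in>B. act (R X b) b) \<in> V"
      unfolding span_B[symmetric] by (intro cv.span_sum cv.span_scale cv.span_base)
    then have "snd (\<Sum>b\<in>B. act (R X b) b) = 0"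
      by (simp add: V_def)
    moreover have "snd X = snd (act (R X E') E') + snd (\<Sum>b\<in>B. act (R X b) b)"
      by (subst R[of X]) (rule snd_add)
    ultimately have "snd X = snd (act (R X E') E')"
      by simp
    then show ?thesis
      using that s_pos by (simp add: act_def E'_V)
  qed
  have "\<forall>b\<in>B. \<exists>z. F b = act z b"
    using B(2) by (auto simp: S_def)
  then obtain ev where ev: "\<And>b. b \<in> B \<Longrightarrow> F b = act (ev b) b"
    unfolding bchoice_iff by blast
  have e_B: "e \<noteq> 0 \<Longrightarrow> e \<in> B"
    using B(1) by (simp add: B0_def split: if_splits)
  have R_F: "R (F X) E' = of_real a * R X E'"
    "b \<in> B \<Longrightarrow> R (F X) b = ev b * R X b + (if b = e then R X E' else 0)" if X: "snd X = 0" for X b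
  proof -
    have BV: "b \<in> V" if "b \<in> B" for b
      using that B(2) by (auto simp: S_def)
    define \<gamma> where "\<gamma> = Re (R X E')"
    \<comment> \<open>\<open>F\<close> is complex linear only on \<open>V\<close>, so it is the
      realness of this coefficient that lets \<open>F\<close> pass it.\<close>
    have r: "R X E' = of_real \<gamma>"
      using R_E'[OF X] by (simp add: \<gamma>_def complex_eq_iff)
    have "F X = F (\<gamma> *\<^sub>R E' + (\<Sum>b\<in>B. act (R X b) b))"
      using arg_cong[OF R[of X], of F] unfolding r act_of_real .
    also have "\<dots> = \<gamma> *\<^sub>R F E' + (\<Sum>b\<in>B. act (R X b * ev b) b)"
      using BV ev by (simp add: F_simps linear_sum[OF linear_F] F_act cong: sum.cong)
    also have "\<dots> = act (R X E' * of_real a) E' + act (R X E') e + (\<Sum>b\<in>B. act (R X b * ev b) b)"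
      unfolding F_E' r of_real_mult[symmetric] act_of_real by (simp add: scaleR_add_right)
    finally have FX: "F X = act (R X E' * of_real a) E' + act (R X E') e + (\<Sum>b\<in>B. act (R X b * ev b) b)" .
    have Re: "R e b = (if b = e then 1 else 0)" if "b \<in> C" for b
    proof (cases "e = 0")
      case True
      then have "b \<noteq> e"
        using that indep_C cv.dependent_zero by blast
      then show ?thesis
        using True cv.representation_zero[of C] by (simp add: R_def)
    next
      case False
      then show ?thesis
        using R_C[of e b] e_B by (simp add: C_def)
    qed
    have "E' \<noteq> e"
      using E'_B span_B e(1) by auto
    moreover have "(\<Sum>b\<in>B. R X b * ev b * R b E') = 0"
      using E'_B(2) by (intro sum.neutral) (auto simp: R_C C_def)
    ultimately show "R (F X) E' = of_real a * R X E'"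
      unfolding FX using finB
      by (simp add: R_add R_act R_sum R_C[of E'] Re C_def)
    assume b: "b \<in> B"
    have "b \<noteq> E'"
      using b E'_B by auto
    have "(\<Sum>x\<in>B. R X x * ev x * R x b) = (\<Sum>x\<in>B. if x = b then ev b * R X b else 0)"
      by (intro sum.cong) (auto simp: R_C C_def)
    also have "\<dots> = ev b * R X b"
      using b finB by simp
    finally show "R (F X) b = ev b * R X b + (if b = e then R X E' else 0)"
      unfolding FX using \<open>b \<noteq> E'\<close> b finB
      by (simp add: R_add R_act R_sum R_C[of E'] Re C_def)
  qed
  \<comment> \<open>An enumeration of the eigenbasis that starts with \<open>e\<close> whenever
    \<open>e\<close> is nonzero, so that the block sits in the pair number 0.\<close>
  obtain xs where xs: "bij_betw xs {..<k} B" "e \<noteq> 0 \<Longrightarrow> k > 0 \<and> xs 0 = e"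
  proof -
    obtain h where h: "bij_betw h {..<k} B"
      using ex_bij_betw_nat_finite[OF finB] \<open>card B = k\<close> by (auto simp: lessThan_atLeast0)
    show ?thesis
    proof (cases "e = 0")
      case False
      then obtain j where j: "j < k" "h j = e"
        using h e_B unfolding bij_betw_def by (metis imageE lessThan_iff)
      have "bij_betw (h \<circ> Transposition.transpose 0 j) {..<k} B"
        using j by (intro bij_betw_trans[OF _ h] permutes_imp_bij permutes_swap_id) auto
      then show ?thesis
        using that j by simp
    qed (use that h in blast)
  qed
  have xs_B: "xs i \<in> B" if "i < k" for i
    using xs(1) that by (auto simp: bij_betw_def)
  define c where "c v = Re (R (v, 0) E')" for v
  define \<zeta> where "\<zeta> i v = R (v, 0) (xs i)" for i v
  define z where "z i = ev (xs i)" for i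
  define w where "w i = (if xs i = e then 1 else 0 :: complex)" for i
  have c: "R (v, 0) E' = of_real (c v)" for v
    using R_E'[of "(v, 0)"] by (simp add: c_def complex_eq_iff)
  have F_pair: "F (v, 0) = (f v, 0)" for v
    by (simp add: F_def)
  have lin: "linear (\<lambda>v. R (v, 0) b)" for b
    using R_add[of "(_, 0)" "(_, 0)" b] R_act[of "of_real _" "(_, 0)" b]
    by (intro linearI) (auto simp: act_of_real scaleR_conv_of_real[where 'a=complex])
  have nf: "normal_form f k a z w c \<zeta>"
  proof (rule normal_form.intro)
    show "linear f" by (rule linear_f)
    show "CARD('m) = 2 * k + 1" by (rule card)
    show "linear c"
      using linear_add[OF lin[of E']] linear_scale[OF lin[of E']] by (intro linearI) (auto simp: c_def)
    show "linear (\<zeta> i)" for i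
      using lin by (simp add: \<zeta>_def[abs_def])
    show "c (f v) = a * c v" for v
      using R_F(1)[of "(v, 0)"] unfolding c_def F_pair by simp
    show "\<zeta> i (f v) = z i * \<zeta> i v + w i * of_real (c v)" if "i < k" for i v
      using R_F(2)[OF _ xs_B[OF that], of "(v, 0)"] unfolding \<zeta>_def F_pair z_def w_def c by simp
    fix v assume v: "c v = 0" "\<And>i. i < k \<Longrightarrow> \<zeta> i v = 0"
    have "R (v, 0) b = 0" if "b \<in> B" for b
      using xs(1) v(2) that unfolding \<zeta>_def bij_betw_def by (metis imageE lessThan_iff)
    then have "act (R (v, 0) E') E' + (\<Sum>b\<in>B. act (R (v, 0) b) b) = 0"
      using c[of v] v(1) by simp
    with R[of "(v, 0)"] have "(v, 0 :: real) = 0"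
      by (rule trans)
    then show "v = 0"
      by (simp add: zero_prod_def)
  qed
  moreover have Re_z: "\<forall>i<k. Re (z i) \<in> {0, - a / 2}"
  proof (intro allI impI)
    fix i assume "i < k"
    then have "xs i \<in> V" "xs i \<noteq> 0" "F (xs i) = act (z i) (xs i)"
      using xs_B[of i] B(2,3) ev cv.dependent_zero[of B] by (auto simp: S_def z_def)
    then show "Re (z i) \<in> {0, - a / 2}"
      by (rule eigenvalue_V)
  qed
  moreover have "(\<forall>i<k. w i = 0) \<or> k > 0 \<and> a = 0 \<and> z 0 = 0 \<and> (\<forall>i<k. w i = (if i = 0 then 1 else 0))"
  proof (cases "e = 0")
    case True
    then show ?thesis
    proof -
      have "0 \<notin> B"
        using B(3) cv.dependent_zero[of B] by blast
      then have "xs i \<noteq> e" if "i < k" for i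
        using xs_B[OF that] True by auto
      then show ?thesis
        by (simp add: w_def)
    qed
  next
    case False
    have "act (z 0) e = 0"
      using ev[of e] e_B e(2) False e_eig xs(2) by (simp add: z_def)
    then have "z 0 = 0"
      using False by simp
    moreover have "w i = (if i = 0 then 1 else 0)" if "i < k" for i
      using that xs False unfolding w_def bij_betw_def inj_on_def by auto
    ultimately show ?thesis
      using False e_eig xs(2) by blast
  qed
  ultimately show ?thesis
    by blast
qed

end

section \<open>The classification\<close>

theorem corollary4p7:
  fixes f :: "real ^ 'm \<Rightarrow> real ^ 'm" and n :: nat
  assumes "linear f" and "CARD('m) + 1 = 2 * n"
  shows "(\<exists>g J. skt_structure (almost_abelian_bracket f) g J) \<longleftrightarrow>
    (diagonalizable_mat (complex_matrix f) \<and>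
     (\<exists>(a::real) (zs::complex list).
        length zs = n - 1 \<and>
        proots (char_poly (complex_matrix f)) =
          mset (complex_of_real a # concat (map (\<lambda>z. [z, cnj z]) zs)) \<and>
        (\<forall>z\<in>set zs. Re z \<in> {0, - a / 2})))
    \<or>
    (\<exists>bs::real list.
        length bs + 2 = n \<and>
        jordan_nf (complex_matrix f)
          ((2, 0) # concat (map (\<lambda>b. [(1, \<i> * complex_of_real b), (1, - (\<i> * complex_of_real b))]) bs)
            @ [(1, 0)]))"
proof -
  define k where "k = n - 1"
  have card: "CARD('m) = 2 * k + 1"
    using assms(2) by (simp add: k_def)
  have n: "length bs + 2 = n \<longleftrightarrow> length bs + 1 = k" for bs :: "real list"
    using assms(2) by (auto simp: k_def)
  have cong: "spectral_coords f k a z w \<phi> \<longleftrightarrow> spectral_coords f k a z' w' \<phi>"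
    if "\<And>i. i < k \<Longrightarrow> z i = z' i" "\<And>i. i < k \<Longrightarrow> w i = w' i" for a z z' w w' \<phi>
    using that by (simp add: spectral_coords_def)
  \<comment> \<open>One construction serves both alternatives, which are the cases
    \<open>w = 0\<close> and \<open>w\<close> supported at index 0 with
    \<open>a = 0\<close>.\<close>
  have skt: "\<exists>g J. skt_structure (almost_abelian_bracket f) g J"
    if "spectral_coords f k a z w \<phi>" "\<forall>i<k. Re (z i) \<in> {0, - a / 2}" for a z w \<phi>
    using spectral_coords_imp_normal_form[OF assms(1) card that(1)] that(2) normal_form.ex_skt_structure
    by blast
  show ?thesis
    unfolding n jordan_nf_iff_spectral_coords[OF assms(1) card] k_def[symmetric]
      diagonalizable_iff_spectral_coords[OF assms(1) card]
  proof (intro iffI; (elim disjE exE conjE)?)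
    fix g J assume "skt_structure (almost_abelian_bracket f) g J"
    then interpret skt_almost_abelian f g J
      by (intro skt_almost_abelian.intro assms(1))
    obtain b z w c \<zeta> where nf: "normal_form f k b z w c \<zeta>" and z: "\<forall>i<k. Re (z i) \<in> {0, - b / 2}"
      and w: "(\<forall>i<k. w i = 0) \<or> k > 0 \<and> b = 0 \<and> z 0 = 0 \<and> (\<forall>i<k. w i = (if i = 0 then 1 else 0))"
      using ex_normal_form[OF card] by blast
    obtain \<phi> where \<phi>: "spectral_coords f k b z w \<phi>"
      using normal_form.ex_spectral_coords[OF nf] by blast
    from w show "(\<exists>a z \<phi>. spectral_coords f k a z (\<lambda>_. 0) \<phi> \<and> (\<forall>i<k. Re (z i) \<in> {0, - a / 2})) \<or>
      (\<exists>bs. length bs + 1 = k \<and>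
        (\<exists>\<phi>. spectral_coords f k 0 (jordan_eigenvalues bs) (\<lambda>i. if i = 0 then 1 else 0) \<phi>))"
    proof (elim disjE conjE)
      assume "\<forall>i<k. w i = 0"
      then have "spectral_coords f k b z (\<lambda>_. 0) \<phi>"
        using \<phi> cong[of z z w "\<lambda>_. 0"] by simp
      then show ?thesis
        using z by blast
    next
      assume *: "k > 0" "b = 0" "z 0 = 0" "\<forall>i<k. w i = (if i = 0 then 1 else 0)"
      \<comment> \<open>Since \<open>b = 0\<close>, all \<open>z i\<close> are purely imaginary; the
        pair at index 0 belongs to the block, so the list starts at index 1.\<close>
      define bs where "bs = map (\<lambda>i. Im (z (i + 1))) [0..<k - 1]"
      have "z i = jordan_eigenvalues bs i" if "i < k" for i
        using that z *(2,3) by (auto simp: jordan_eigenvalues_def bs_def complex_eq_iff)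
      then have "spectral_coords f k 0 (jordan_eigenvalues bs) (\<lambda>i. if i = 0 then 1 else 0) \<phi>"
        using \<phi> cong[of z "jordan_eigenvalues bs" w "\<lambda>i. if i = 0 then 1 else 0"] *(2,4) by simp
      moreover have "length bs + 1 = k"
        using *(1) by (simp add: bs_def)
      ultimately show ?thesis
        by blast
    qed
  next
    fix a z \<phi> assume "spectral_coords f k a z (\<lambda>_. 0) \<phi>" "\<forall>i<k. Re (z i) \<in> {0, - a / 2}"
    then show "\<exists>g J. skt_structure (almost_abelian_bracket f) g J"
      by (rule skt)
  next
    fix bs \<phi> assume "spectral_coords f k 0 (jordan_eigenvalues bs) (\<lambda>i. if i = 0 then 1 else 0) \<phi>"
    then show "\<exists>g J. skt_structure (almost_abelian_bracket f) g J"
      by (rule skt) (simp add: jordan_eigenvalues_def)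
  qed
qed

end
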